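(* Let $N,k\ge 2$ and let $\mathbf{u}=(u_1,\dots,u_k)$ be a nonnegative solution of $-\Delta u_i=-\sum_{j\ne i}u_j^2u_i$ in $\mathbb{R}^N$, $i=1,\dots,k$, having algebraic growth. Then $d:=N(\mathbf{u},0,+\infty)\in(0,+\infty)$ is the growth rate of $\mathbf{u}$.
   Context: A nonnegative solution is one with $u_i\ge0$ in $\mathbb{R}^N$ for every $i$, where some $u_i$ may vanish identically, but at least two components are non-trivial. Algebraic growth: there exist $C>0$ and $d>1$ such that $u_1(x)+\cdots+u_k(x)\le C(1+|x|^d)$ for every $x\in\mathbb{R}^N$. For $x_0\in\mathbb{R}^N$, $r>0$ set $$H(\mathbf{u},x_0,r):=\frac{1}{r^{N-1}}\int_{\partial B_r(x_0)}\sum_{i=1}^ku_i^2,$$ $$E(\mathbf{u},x_0,r):=\frac{1}{r^{N-2}}\int_{B_r(x_0)}\Big(\sum_{i=1}^k|\nabla u_i|^2+\sum_{1\le i<j\le k}u_i^2u_j^2\Big),$$ $$N(\mathbf{u},x_0,r):=\frac{E(\mathbf{u},x_0,r)}{H(\mathbf{u},x_0,r)}.$$ The function $r\mapsto N(\mathbf{u},x_0,r)$ is non-decreasing, and $N(\mathbf{u},x_0,+\infty):=\lim_{r\to+\infty}N(\mathbf{u},x_0,r)$. $\mathbf{u}$ has growth rate $d$ if $\lim_{r\to+\infty}H(\mathbf{u},0,r)/r^{2d'}=+\infty$ for every $d'<d$ and $\lim_{r\to+\infty}H(\mathbf{u},0,r)/r^{2d'}=0$ for every $d'>d$. *)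

theory Defs
  imports "HOL-Analysis.Analysis"
begin

section \<open>Derivatives\<close>

definition partial_deriv :: "'a::euclidean_space \<Rightarrow> ('a \<Rightarrow> real) \<Rightarrow> 'a \<Rightarrow> real" where
  "partial_deriv b f x = frechet_derivative f (at x) b"

definition grad :: "('a::euclidean_space \<Rightarrow> real) \<Rightarrow> 'a \<Rightarrow> 'a" where
  "grad f x = (\<Sum>b\<in>Basis. partial_deriv b f x *\<^sub>R b)"

definition laplacian :: "('a::euclidean_space \<Rightarrow> real) \<Rightarrow> 'a \<Rightarrow> real" where
  "laplacian f x = (\<Sum>b\<in>Basis. partial_deriv b (partial_deriv b f) x)"

text \<open>Twice continuously differentiable on the whole space. Without differentiability,
  \<^const>\<open>frechet_derivative\<close> is an arbitrary value, so it has to be demanded explicitly.\<close>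

definition twice_cont_diff :: "('a::euclidean_space \<Rightarrow> real) \<Rightarrow> bool" where
  "twice_cont_diff f \<longleftrightarrow>
     (\<forall>x. f differentiable (at x)) \<and>
     (\<forall>b\<in>Basis. \<forall>x. partial_deriv b f differentiable (at x)) \<and>
     (\<forall>b\<in>Basis. \<forall>c\<in>Basis. continuous_on UNIV (partial_deriv c (partial_deriv b f)))"


section \<open>Surface measure on spheres\<close>

text \<open>The library has no surface measure. As usual for polar coordinates, a set \<open>A\<close>
  on the sphere of radius \<open>r > 0\<close> around \<open>x0\<close> in dimension \<open>N\<close> is given the measure
  \<open>N / r\<close> times the Lebesgue measure of the solid cone spanned by \<open>x0\<close> and \<open>A\<close>; this is
  the (\<open>N - 1\<close>)-dimensional area. Below, the cone over \<open>A\<close> is the preimage of \<open>A\<close> under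
  radial projection of the ball to the sphere (the centre, a null set, is sent to itself).\<close>

definition sphere_measure :: "'a::euclidean_space \<Rightarrow> real \<Rightarrow> 'a measure" where
  "sphere_measure x0 r =
     distr (density lborel (\<lambda>x. ennreal (real DIM('a) / r) * indicator (ball x0 r) x))
       borel (\<lambda>x. x0 + r *\<^sub>R sgn (x - x0))"

lemma emeasure_sphere_measure_total:
  fixes x0 :: "'a::euclidean_space"
  assumes "r > 0"
  shows "emeasure (sphere_measure x0 r) UNIV
         = ennreal (real DIM('a) * unit_ball_vol (real DIM('a)) * r ^ (DIM('a) - 1))"
proof -
  have pow: "r ^ DIM('a) = r * r ^ (DIM('a) - 1)"
    by (metis DIM_positive power_eq_if not_gr_zero)
  have [measurable]: "(\<lambda>x. ennreal (real DIM('a) / r) * indicator (ball x0 r) x)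
      \<in> borel_measurable lborel"
    by (intro borel_measurable_times_ennreal borel_measurable_const borel_measurable_indicator) simp
  have "emeasure (sphere_measure x0 r) UNIV
      = emeasure (density lborel (\<lambda>x. ennreal (real DIM('a) / r) * indicator (ball x0 r) x)) UNIV"
    unfolding sphere_measure_def by (subst emeasure_distr) auto
  also have "\<dots> = (\<integral>\<^sup>+x. ennreal (real DIM('a) / r) * indicator (ball x0 r) x \<partial>lborel)"
    by (subst emeasure_density) simp_all
  also have "\<dots> = ennreal (real DIM('a) / r) * emeasure lborel (ball x0 r)"
    by (rule nn_integral_cmult_indicator) simp
  also have "\<dots> = ennreal (real DIM('a) / r * (unit_ball_vol (real DIM('a)) * r ^ DIM('a)))"
    using assms by (simp add: emeasure_ball ennreal_mult[symmetric])
  also have "real DIM('a) / r * (unit_ball_vol (real DIM('a)) * r ^ DIM('a))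
      = real DIM('a) * unit_ball_vol (real DIM('a)) * r ^ (DIM('a) - 1)"
    using assms by (simp add: pow)
  finally show ?thesis .
qed

lemma AE_sphere_measure:
  fixes x0 :: "'a::euclidean_space"
  assumes "r > 0"
  shows "AE x in sphere_measure x0 r. x \<in> sphere x0 r"
proof -
  have [measurable]: "(\<lambda>x. ennreal (real DIM('a) / r) * indicator (ball x0 r) x)
      \<in> borel_measurable lborel"
    by (intro borel_measurable_times_ennreal borel_measurable_const borel_measurable_indicator) simp
  have "AE x in lborel. x \<noteq> x0"
    by (rule AE_lborel_singleton)
  then have "AE x in density lborel (\<lambda>x. ennreal (real DIM('a) / r) * indicator (ball x0 r) x).
      x \<noteq> x0"
    by (subst AE_density) (simp, auto elim!: eventually_mono)
  then have "AE x in density lborel (\<lambda>x. ennreal (real DIM('a) / r) * indicator (ball x0 r) x).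
      x0 + r *\<^sub>R sgn (x - x0) \<in> sphere x0 r"
    by (rule eventually_mono) (use assms in \<open>auto simp: dist_norm norm_sgn\<close>)
  then show ?thesis
    unfolding sphere_measure_def by (subst AE_distr_iff) auto
qed


section \<open>The system and the Almgren frequency\<close>

text \<open>A vector of \<open>k\<close> functions is \<open>u :: nat \<Rightarrow> 'a \<Rightarrow> real\<close>, of which only the
  components \<open>u 1, \<dots>, u k\<close> are ever used.\<close>

definition solves_system :: "nat \<Rightarrow> (nat \<Rightarrow> 'a::euclidean_space \<Rightarrow> real) \<Rightarrow> bool" where
  "solves_system k u \<longleftrightarrow>
     (\<forall>i\<in>{1..k}. twice_cont_diff (u i)) \<and>
     (\<forall>i\<in>{1..k}. \<forall>x. - laplacian (u i) x = - (\<Sum>j\<in>{1..k} - {i}. (u j x)\<^sup>2 * u i x))"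

definition nonneg_solution :: "nat \<Rightarrow> (nat \<Rightarrow> 'a::euclidean_space \<Rightarrow> real) \<Rightarrow> bool" where
  "nonneg_solution k u \<longleftrightarrow>
     solves_system k u \<and>
     (\<forall>i\<in>{1..k}. \<forall>x. u i x \<ge> 0) \<and>
     (\<exists>i\<in>{1..k}. \<exists>j\<in>{1..k}. i \<noteq> j \<and> (\<exists>x. u i x \<noteq> 0) \<and> (\<exists>x. u j x \<noteq> 0))"

definition algebraic_growth :: "nat \<Rightarrow> (nat \<Rightarrow> 'a::euclidean_space \<Rightarrow> real) \<Rightarrow> bool" where
  "algebraic_growth k u \<longleftrightarrow>
     (\<exists>C d :: real. C > 0 \<and> d > 1 \<and> (\<forall>x. (\<Sum>i=1..k. u i x) \<le> C * (1 + norm x powr d)))"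

definition H_fun :: "nat \<Rightarrow> (nat \<Rightarrow> 'a::euclidean_space \<Rightarrow> real) \<Rightarrow> 'a \<Rightarrow> real \<Rightarrow> real" where
  "H_fun k u x0 r =
     1 / r ^ (DIM('a) - 1) * (LINT x|sphere_measure x0 r. (\<Sum>i=1..k. (u i x)\<^sup>2))"

definition E_fun :: "nat \<Rightarrow> (nat \<Rightarrow> 'a::euclidean_space \<Rightarrow> real) \<Rightarrow> 'a \<Rightarrow> real \<Rightarrow> real" where
  "E_fun k u x0 r =
     1 / r ^ (DIM('a) - 2) *
     (LINT x:ball x0 r|lborel.
        (\<Sum>i=1..k. (norm (grad (u i) x))\<^sup>2) +
        (\<Sum>i=1..k. \<Sum>j=i+1..k. (u i x)\<^sup>2 * (u j x)\<^sup>2))"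

definition N_fun :: "nat \<Rightarrow> (nat \<Rightarrow> 'a::euclidean_space \<Rightarrow> real) \<Rightarrow> 'a \<Rightarrow> real \<Rightarrow> real" where
  "N_fun k u x0 r = E_fun k u x0 r / H_fun k u x0 r"

text \<open>The limit is taken in the extended reals, where it may be infinite.\<close>

definition N_infinity :: "nat \<Rightarrow> (nat \<Rightarrow> 'a::euclidean_space \<Rightarrow> real) \<Rightarrow> 'a \<Rightarrow> ereal" where
  "N_infinity k u x0 = Lim at_top (\<lambda>r. ereal (N_fun k u x0 r))"

definition has_growth_rate :: "nat \<Rightarrow> (nat \<Rightarrow> 'a::euclidean_space \<Rightarrow> real) \<Rightarrow> real \<Rightarrow> bool" where
  "has_growth_rate k u d \<longleftrightarrow>
     (\<forall>d'<d. filterlim (\<lambda>r. H_fun k u 0 r / r powr (2 * d')) at_top at_top) \<and>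
     (\<forall>d'>d. ((\<lambda>r. H_fun k u 0 r / r powr (2 * d')) \<longlongrightarrow> 0) at_top)"

end

theory Submission
  imports Defs "HOL-Real_Asymp.Real_Asymp"
begin

text \<open>Write \<open>N\<close> for the dimension, \<open>H\<close> and \<open>E\<close> for the scaled spherical integral of \<open>\<Sum>i. u\<^sub>i\<^sup>2\<close> and the scaled energy, and put
\<open>W = (\<Sum>i<j. u\<^sub>i\<^sup>2 u\<^sub>j\<^sup>2)\<close>, \<open>I(r) = r\<^bsup>2-N\<^esup> \<integral>\<^bsub>B(r)\<^esub> W\<close>. The proof is Almgren's monotonicity formula,
with the lower order term \<open>I\<close> kept instead of being thrown away.

Two applications of the divergence theorem on balls carry the argument. Applied to
\<open>\<Sum>i. u\<^sub>i \<nabla>u\<^sub>i\<close>, whose divergence is \<open>(\<Sum>i. |\<nabla>u\<^sub>i|\<^sup>2) + 2 W\<close> by the equations, it gives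
\<open>H' = (2/r) (E + I)\<close>. Applied to the Pohozaev field
\<open>((\<Sum>i. |\<nabla>u\<^sub>i|\<^sup>2) + W) x - 2 (\<Sum>i. (x \<bullet> \<nabla>u\<^sub>i) \<nabla>u\<^sub>i)\<close> it gives \<open>E'\<close> in terms of \<open>I\<close> and the normal
derivatives on the sphere, because the system is variational: \<open>\<Delta>u\<^sub>i\<close> is half the partial
derivative of \<open>W\<close> with respect to \<open>u\<^sub>i\<close>. Together with the Cauchy-Schwarz inequality on the sphere these
formulas say that the frequency \<open>n = E / H\<close> satisfies \<open>n' \<ge> 2 I / (r H)\<close>, while
\<open>(ln H)' = 2 n / r + 2 I / (r H)\<close>. Hence
\<open>2 n / r \<le> (ln H)' \<le> 2 n / r + n'\<close>.

All conclusions follow from these inequalities. As \<open>n\<close> is nondecreasing, the first one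
gives \<open>H(r) \<ge> c r\<^bsup>2 n(s)\<^esup>\<close> for \<open>r \<ge> s\<close>. Comparison with the algebraic growth of \<open>u\<close> bounds
\<open>n\<close>, so \<open>n\<close> has a finite limit \<open>d\<close>, and \<open>H\<close> dominates every power \<open>r\<^bsup>2d'\<^esup>\<close> with \<open>d' < d\<close>. The second
one shows that \<open>ln H - n - 2 d ln r\<close> is nonincreasing, so that \<open>H(r) \<le> K r\<^bsup>2d\<^esup>\<close>: the
excess of the logarithmic derivative of \<open>H\<close> is integrable, its integral being at most the total
increase of \<open>n\<close>. Finally \<open>d > 0\<close>, since otherwise all gradients and \<open>W\<close> vanish, the
components are constant, and two of them would be nonzero constants with vanishing product.

The surface measure is given by volumes of cones, so polar coordinates and the divergence theorem
on balls are established first, from Fubini's theorem and the translation invariance of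
Lebesgue measure.\<close>

section \<open>The sphere measure and polar coordinates\<close>

abbreviation unit_sphere_measure :: "'a::euclidean_space measure" where
  "unit_sphere_measure \<equiv> sphere_measure 0 1"

lemma nn_integral_lborel_scaling:
  fixes f :: "'a::euclidean_space \<Rightarrow> ennreal"
  assumes [measurable]: "f \<in> borel_measurable borel" and c: "c > 0"
  shows "(\<integral>\<^sup>+x. f x \<partial>lborel) = ennreal (c ^ DIM('a)) * (\<integral>\<^sup>+x. f (c *\<^sub>R x) \<partial>lborel)"
proof -
  have "(\<integral>\<^sup>+x. f x \<partial>lborel)
      = (\<integral>\<^sup>+x. f x \<partial>density (distr lborel borel (\<lambda>x. 0 + c *\<^sub>R x)) (\<lambda>_. ennreal (\<bar>c\<bar> ^ DIM('a))))"
    using lborel_affine[of c "0::'a"] c by simp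
  also have "\<dots> = ennreal (c ^ DIM('a)) * (\<integral>\<^sup>+x. f (c *\<^sub>R x) \<partial>lborel)"
    using c by (subst nn_integral_density) (auto simp: nn_integral_distr nn_integral_cmult)
  finally show ?thesis .
qed

lemma borel_measurable_sgn_euclidean [measurable (raw)]:
  fixes f :: "'b \<Rightarrow> 'a::euclidean_space"
  assumes "f \<in> borel_measurable M"
  shows "(\<lambda>x. sgn (f x)) \<in> borel_measurable M"
  unfolding sgn_div_norm using assms by measurable

lemma sets_sphere_measure [simp, measurable_cong]: "sets (sphere_measure x r) = sets borel"
  and space_sphere_measure [simp]: "space (sphere_measure x r) = UNIV"
  by (simp_all add: sphere_measure_def)

lemma nn_integral_sphere_measure:
  fixes f :: "'a::euclidean_space \<Rightarrow> ennreal"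
  assumes [measurable]: "f \<in> borel_measurable borel" and r: "r > 0"
  shows "(\<integral>\<^sup>+x. f x \<partial>sphere_measure 0 r)
    = ennreal (real DIM('a) / r) * (\<integral>\<^sup>+x. indicator (ball 0 r) x * f (r *\<^sub>R sgn x) \<partial>lborel)"
proof -
  have [measurable]: "(\<lambda>x::'a. ennreal (real DIM('a) / r) * indicator (ball 0 r) x)
      \<in> borel_measurable lborel"
    by (intro borel_measurable_times_ennreal borel_measurable_const borel_measurable_indicator) simp
  have [measurable]: "ball (0::'a) r \<in> sets borel" "(\<lambda>x. f (r *\<^sub>R sgn x)) \<in> borel_measurable borel"
    by (simp, rule measurable_compose[OF _ assms(1)], measurable)
  show ?thesis
    unfolding sphere_measure_def
    by (subst nn_integral_distr, measurable, simp add: nn_integral_density mult.assoc)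
      (rule nn_integral_cmult, measurable)
qed

lemma finite_measure_unit_sphere: "finite_measure (unit_sphere_measure :: 'a::euclidean_space measure)"
  by (rule finite_measureI) (use emeasure_sphere_measure_total[of 1 "0::'a"] in simp)

lemma AE_unit_sphere_norm: "AE x in unit_sphere_measure. norm (x::'a::euclidean_space) = 1"
  using AE_sphere_measure[of 1 "0::'a"] by simp

text \<open>Dilation by \<open>r\<close> multiplies the volume of a cone by the full power \<open>r\<^bsup>N\<^esup>\<close>, and the normalising
factor of the sphere measure supplies one factor \<open>1 / r\<close>. This reduces every sphere to the unit
sphere, so that the radius enters integrals only through the integrand.\<close>

lemma sphere_measure_eq_scaled_unit_sphere:
  assumes r: "r > 0"
  shows "sphere_measure (0::'a::euclidean_space) r
    = scale_measure (ennreal (r ^ (DIM('a) - 1))) (distr unit_sphere_measure borel (\<lambda>x. r *\<^sub>R x))"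
proof (rule measure_eqI)
  fix A :: "'a set" assume "A \<in> sets (sphere_measure 0 r)"
  then have [measurable]: "A \<in> sets borel" by simp
  have pow: "r ^ DIM('a) = r * r ^ (DIM('a) - 1)"
    by (metis DIM_positive power_eq_if not_gr_zero)
  have [measurable]: "ball (0::'a) r \<in> sets borel"
    "(\<lambda>x. indicator A (r *\<^sub>R sgn x) :: ennreal) \<in> borel_measurable borel"
    by (simp, rule measurable_compose[OF _ borel_measurable_indicator], measurable)
  have ind: "indicator (ball 0 r) (r *\<^sub>R x) = (indicator (ball 0 1) x :: ennreal)" for x :: 'a
    using r by (auto simp: indicator_def)
  have sgn: "sgn (r *\<^sub>R x) = sgn x" for x :: 'a using r by (simp add: sgn_scaleR)
  have "emeasure (sphere_measure 0 r) A = (\<integral>\<^sup>+x. indicator A x \<partial>sphere_measure 0 r)"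
    by simp
  also have "\<dots> = ennreal (real DIM('a) / r) *
       (\<integral>\<^sup>+x. indicator (ball 0 r) x * indicator A (r *\<^sub>R sgn x) \<partial>lborel)"
    by (rule nn_integral_sphere_measure) (use r in auto)
  also have "\<dots> = ennreal (real DIM('a) / r) * (ennreal (r ^ DIM('a)) *
       (\<integral>\<^sup>+x. indicator (ball 0 1) x * indicator A (r *\<^sub>R sgn x) \<partial>lborel))"
    by (subst nn_integral_lborel_scaling[OF _ r], measurable, simp only: ind sgn)
  also have "\<dots> = ennreal (r ^ (DIM('a) - 1)) * (ennreal (real DIM('a) / 1) * 
       (\<integral>\<^sup>+x. indicator (ball 0 1) x * indicator A (r *\<^sub>R (1 *\<^sub>R sgn x)) \<partial>lborel))"
    using r by (simp add: pow mult.assoc[symmetric] ennreal_mult[symmetric])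
       (simp add: mult.commute)
  also have "\<dots> = ennreal (r ^ (DIM('a) - 1)) * (\<integral>\<^sup>+x. indicator A (r *\<^sub>R x) \<partial>unit_sphere_measure)"
    by (subst nn_integral_sphere_measure[where r=1]) auto
  also have "\<dots> = emeasure (scale_measure (ennreal (r ^ (DIM('a) - 1)))
       (distr unit_sphere_measure borel (\<lambda>x. r *\<^sub>R x))) A"
    by (simp add: emeasure_distr nn_integral_distr nn_integral_indicator[symmetric] del: nn_integral_indicator)
  finally show "emeasure (sphere_measure 0 r) A = \<dots>" .
qed simp

text \<open>Polar coordinates, by Fubini alone. An integral over the unit sphere is an integral over the
solid unit ball of a function of \<open>y / |y|\<close>. Substituting \<open>\<rho> = s |y|\<close> for the radius replaces the
direction \<open>y / |y|\<close> by \<open>y\<close> itself, and substituting \<open>z = s y\<close> next leaves the integral of \<open>h\<close> against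
the factor \<open>N |z|\<^bsup>N\<^esup> \<integral> s\<^bsup>-N-1\<^esup> ds\<close> over \<open>s > |z|\<close>, which is \<open>1\<close>.\<close>

lemma nn_integral_polar:
  fixes h :: "'a::euclidean_space \<Rightarrow> ennreal"
  assumes [measurable]: "h \<in> borel_measurable borel"
  shows "(\<integral>\<^sup>+\<rho>. indicator {0<..} \<rho> * ennreal (\<rho> ^ (DIM('a) - 1)) *
            (\<integral>\<^sup>+x. h (\<rho> *\<^sub>R x) \<partial>unit_sphere_measure) \<partial>lborel) = (\<integral>\<^sup>+x. h x \<partial>lborel)"
proof -
  let ?N = "DIM('a)"
  define n where "n = ?N - 1"
  have N: "?N = Suc n" using DIM_positive[where 'a='a] unfolding n_def by simp
  have [measurable]: "ball (0::'a) 1 \<in> sets borel" by simp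
  \<comment> \<open>the substitution \<open>\<rho> = s |y|\<close>, for fixed \<open>y\<close>\<close>
  have radial: "ennreal (real ?N) * (\<integral>\<^sup>+\<rho>. indicator {0<..} \<rho> * (ennreal (\<rho> ^ n) * h (\<rho> *\<^sub>R sgn y)) \<partial>lborel)
     = ennreal (real ?N) * (\<integral>\<^sup>+s. indicator {0<..} s * (ennreal (s ^ n * norm y ^ ?N) * h (s *\<^sub>R y)) \<partial>lborel)"
    if "y \<noteq> 0" for y :: 'a
  proof -
    have pos: "norm y > 0" using that by simp
    have "(\<integral>\<^sup>+\<rho>. indicator {0<..} \<rho> * (ennreal (\<rho> ^ n) * h (\<rho> *\<^sub>R sgn y)) \<partial>lborel)
      = ennreal (norm y) * (\<integral>\<^sup>+s. indicator {0<..} (norm y * s) *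
          (ennreal ((norm y * s) ^ n) * h ((norm y * s) *\<^sub>R sgn y)) \<partial>lborel)"
      using nn_integral_real_affine[of "\<lambda>\<rho>. indicator {0<..} \<rho> * (ennreal (\<rho> ^ n) * h (\<rho> *\<^sub>R sgn y))"
        "norm y" 0] pos by simp
    also have "\<dots> = (\<integral>\<^sup>+s. ennreal (norm y) * (indicator {0<..} (norm y * s) *
          (ennreal ((norm y * s) ^ n) * h ((norm y * s) *\<^sub>R sgn y))) \<partial>lborel)"
      by (rule nn_integral_cmult[symmetric]) measurable
    also have "\<dots> = (\<integral>\<^sup>+s. indicator {0<..} s * (ennreal (s ^ n * norm y ^ ?N) * h (s *\<^sub>R y)) \<partial>lborel)"
    proof (rule nn_integral_cong)
      fix s :: real
      have 1: "(norm y * s) *\<^sub>R sgn y = s *\<^sub>R y"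
        using pos by (simp add: sgn_div_norm)
      have 2: "ennreal (norm y) * ennreal ((norm y * s) ^ n) = ennreal (s ^ n * norm y ^ ?N)" if "s > 0"
        using that pos by (subst ennreal_mult[symmetric]) (auto simp: N power_mult_distrib mult_ac)
      show "ennreal (norm y) * (indicator {0<..} (norm y * s) *
          (ennreal ((norm y * s) ^ n) * h ((norm y * s) *\<^sub>R sgn y)))
         = indicator {0<..} s * (ennreal (s ^ n * norm y ^ ?N) * h (s *\<^sub>R y))"
      proof (cases "s > 0")
        case True
        then show ?thesis using pos unfolding 1 by (simp add: 2[symmetric] mult.assoc)
      next
        case False
        then show ?thesis using pos by (simp add: zero_less_mult_iff)
      qed
    qed
    finally show ?thesis by simp
  qed
  \<comment> \<open>the total weight that a point \<open>z\<close> receives from the dilations \<open>s > |z|\<close>\<close>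
  have tail: "(\<integral>\<^sup>+s. ennreal (real ?N) * (indicator {0<..} s * ennreal (s ^ n * (1 / s ^ ?N) * (norm z / s) ^ ?N) *
        indicator (ball 0 s) z) \<partial>lborel) = 1" if "z \<noteq> 0" for z :: 'a
  proof -
    have pos: "norm z > 0" using that by simp
    have "(\<integral>\<^sup>+s. ennreal (real ?N) * (indicator {0<..} s * ennreal (s ^ n * (1 / s ^ ?N) * (norm z / s) ^ ?N) *
        indicator (ball 0 s) z) \<partial>lborel)
      = (\<integral>\<^sup>+s. ennreal (real ?N * norm z ^ ?N / s ^ Suc ?N) * indicator {norm z..} s \<partial>lborel)"
    proof (rule nn_integral_cong_AE, rule AE_mp[OF AE_lborel_singleton[of "norm z"]], rule AE_I2, rule impI)
      fix s :: real assume "s \<noteq> norm z"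
      then show "ennreal (real ?N) * (indicator {0<..} s * ennreal (s ^ n * (1 / s ^ ?N) * (norm z / s) ^ ?N) *
        indicator (ball 0 s) z) = ennreal (real ?N * norm z ^ ?N / s ^ Suc ?N) * indicator {norm z..} s"
      proof (cases "s > norm z")
        case True
        then have s: "s > 0" using pos by linarith
        have "real ?N * (s ^ n * (1 / s ^ ?N) * (norm z / s) ^ ?N) = real ?N * norm z ^ ?N / s ^ Suc ?N"
          using s by (simp add: N power_divide field_simps)
        then show ?thesis using True s pos
          by (simp only: indicator_simps(1) greaterThan_iff atLeast_iff mem_ball dist_0_norm mult_1_left mult_1_right less_imp_le)
            (simp only: ennreal_mult'[symmetric] of_nat_0_le_iff)
      qed (use pos in auto)
    qed
    also have "\<dots> = ennreal (0 - (- (norm z ^ ?N / norm z ^ ?N)))"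
    proof (rule nn_integral_FTC_atLeast[where F="\<lambda>s. - (norm z ^ ?N / s ^ ?N)"])
      fix s assume "norm z \<le> s"
      then have s: "s > 0" using pos by linarith
      have d: "((\<lambda>s. s ^ Suc n) has_real_derivative real (Suc n) * s ^ n) (at s)"
        using DERIV_pow[of "Suc n" s] by simp
      show "((\<lambda>s. - (norm z ^ ?N / s ^ ?N)) has_real_derivative real ?N * norm z ^ ?N / s ^ Suc ?N) (at s)"
        using s unfolding N
        by (intro DERIV_cong[OF DERIV_minus[OF DERIV_divide[OF DERIV_const d]]])
          (auto simp: field_simps simp del: of_nat_Suc)
      show "0 \<le> real ?N * norm z ^ ?N / s ^ Suc ?N" using s by simp
    next
      have "filterlim (\<lambda>s::real. s ^ ?N) at_top at_top"
        by (rule filterlim_pow_at_top) (auto simp: filterlim_ident)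
      then have "((\<lambda>s. norm z ^ ?N / s ^ ?N) \<longlongrightarrow> 0) at_top"
        by (intro tendsto_divide_0[OF tendsto_const] filterlim_at_top_imp_at_infinity)
      then show "((\<lambda>s. - (norm z ^ ?N / s ^ ?N)) \<longlongrightarrow> 0) at_top"
        using tendsto_minus by fastforce
    qed measurable
    finally show ?thesis using pos by simp
  qed
  have "(\<integral>\<^sup>+\<rho>. indicator {0<..} \<rho> * ennreal (\<rho> ^ n) * (\<integral>\<^sup>+x. h (\<rho> *\<^sub>R x) \<partial>unit_sphere_measure) \<partial>lborel)
     = (\<integral>\<^sup>+\<rho>. \<integral>\<^sup>+y. ennreal (real ?N) * (indicator (ball 0 1) y * (indicator {0<..} \<rho> * (ennreal (\<rho> ^ n) * h (\<rho> *\<^sub>R sgn y)))) \<partial>(lborel :: 'a measure) \<partial>lborel)"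
  proof (rule nn_integral_cong)
    fix \<rho> :: real
    have [measurable]: "ball (0::'a) 1 \<in> sets borel" by simp
    have "(\<integral>\<^sup>+y. ennreal (real ?N) * (indicator (ball 0 1) y * (indicator {0<..} \<rho> * (ennreal (\<rho> ^ n) * h (\<rho> *\<^sub>R sgn y)))) \<partial>(lborel :: 'a measure))
      = (\<integral>\<^sup>+y. (ennreal (real ?N) * indicator {0<..} \<rho> * ennreal (\<rho> ^ n)) * (indicator (ball 0 1) y * h (\<rho> *\<^sub>R sgn y)) \<partial>lborel)"
      by (simp add: mult_ac)
    also have "\<dots> = (ennreal (real ?N) * indicator {0<..} \<rho> * ennreal (\<rho> ^ n)) * (\<integral>\<^sup>+y. (indicator (ball 0 1) y * h (\<rho> *\<^sub>R sgn y)) \<partial>lborel)"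
      by (rule nn_integral_cmult) measurable
    also have "\<dots> = indicator {0<..} \<rho> * ennreal (\<rho> ^ n) * (\<integral>\<^sup>+x. h (\<rho> *\<^sub>R x) \<partial>unit_sphere_measure)"
      by (simp add: nn_integral_sphere_measure mult_ac)
    finally show "indicator {0<..} \<rho> * ennreal (\<rho> ^ n) * (\<integral>\<^sup>+x. h (\<rho> *\<^sub>R x) \<partial>unit_sphere_measure)
      = (\<integral>\<^sup>+y. ennreal (real ?N) * (indicator (ball 0 1) y * (indicator {0<..} \<rho> * (ennreal (\<rho> ^ n) * h (\<rho> *\<^sub>R sgn y)))) \<partial>(lborel :: 'a measure))"
      by simp
  qed
  also have "\<dots> = (\<integral>\<^sup>+y. \<integral>\<^sup>+\<rho>. ennreal (real ?N) * (indicator (ball 0 1) y * (indicator {0<..} \<rho> * (ennreal (\<rho> ^ n) * h (\<rho> *\<^sub>R sgn y)))) \<partial>lborel \<partial>(lborel :: 'a measure))"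
    by (rule lborel_pair.Fubini') measurable
  also have "\<dots> = (\<integral>\<^sup>+y. \<integral>\<^sup>+s. ennreal (real ?N) * (indicator (ball 0 1) y * (indicator {0<..} s * (ennreal (s ^ n * norm y ^ ?N) * h (s *\<^sub>R y)))) \<partial>lborel \<partial>(lborel :: 'a measure))"
  proof (rule nn_integral_cong_AE, rule AE_mp[OF AE_lborel_singleton[of 0]], rule AE_I2, rule impI)
    fix y :: 'a assume "y \<noteq> 0"
    have "(\<integral>\<^sup>+\<rho>. ennreal (real ?N) * (indicator (ball 0 1) y * (indicator {0<..} \<rho> * (ennreal (\<rho> ^ n) * h (\<rho> *\<^sub>R sgn y)))) \<partial>lborel)
      = indicator (ball 0 1) y * (ennreal (real ?N) * (\<integral>\<^sup>+\<rho>. indicator {0<..} \<rho> * (ennreal (\<rho> ^ n) * h (\<rho> *\<^sub>R sgn y)) \<partial>lborel))"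
      by (cases "y \<in> ball 0 1") (simp_all add: nn_integral_cmult)
    also have "\<dots> = (\<integral>\<^sup>+s. ennreal (real ?N) * (indicator (ball 0 1) y * (indicator {0<..} s * (ennreal (s ^ n * norm y ^ ?N) * h (s *\<^sub>R y)))) \<partial>lborel)"
      unfolding radial[OF \<open>y \<noteq> 0\<close>] by (cases "y \<in> ball 0 1") (simp_all add: nn_integral_cmult)
    finally show "(\<integral>\<^sup>+\<rho>. ennreal (real ?N) * (indicator (ball 0 1) y * (indicator {0<..} \<rho> * (ennreal (\<rho> ^ n) * h (\<rho> *\<^sub>R sgn y)))) \<partial>lborel) = \<dots>" .
  qed
  also have "\<dots> = (\<integral>\<^sup>+s. \<integral>\<^sup>+y. ennreal (real ?N) * (indicator (ball 0 1) y * (indicator {0<..} s * (ennreal (s ^ n * norm y ^ ?N) * h (s *\<^sub>R y)))) \<partial>(lborel :: 'a measure) \<partial>lborel)"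
    by (rule lborel_pair.Fubini'[symmetric]) measurable
  also have "\<dots> = (\<integral>\<^sup>+s. \<integral>\<^sup>+z. ennreal (real ?N) * (indicator {0<..} s * ennreal (s ^ n * (1 / s ^ ?N) * (norm z / s) ^ ?N) *
        indicator (ball 0 s) z) * h z \<partial>(lborel :: 'a measure) \<partial>lborel)"
  proof (rule nn_integral_cong)
    fix s :: real
    show "(\<integral>\<^sup>+y. ennreal (real ?N) * (indicator (ball 0 1) y * (indicator {0<..} s * (ennreal (s ^ n * norm y ^ ?N) * h (s *\<^sub>R y)))) \<partial>(lborel :: 'a measure))
      = (\<integral>\<^sup>+z. ennreal (real ?N) * (indicator {0<..} s * ennreal (s ^ n * (1 / s ^ ?N) * (norm z / s) ^ ?N) *
        indicator (ball 0 s) z) * h z \<partial>(lborel :: 'a measure))"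
    proof (cases "s > 0")
      case True
      have ind: "indicator (ball 0 s) (s *\<^sub>R x) = (indicator (ball 0 1) x :: ennreal)" for x :: 'a
        using True by (auto simp: indicator_def)
      have e: "ennreal (s ^ ?N) * ennreal (s ^ n * (1 / s ^ ?N) * (norm (s *\<^sub>R y) / s) ^ ?N)
          = ennreal (s ^ n * norm y ^ ?N)" for y :: 'a
        using True by (subst ennreal_mult[symmetric]) (auto simp: field_simps)
      have [measurable]: "ball (0::'a) s \<in> sets borel" by simp
      show ?thesis
        apply (subst (2) nn_integral_lborel_scaling[OF _ True])
         apply measurable
        apply (subst nn_integral_cmult[symmetric])
         apply measurable
        apply (rule nn_integral_cong)
        apply (simp only: ind e[symmetric])
        apply (simp add: mult_ac)
        done
    qed simp
  qed
  also have "\<dots> = (\<integral>\<^sup>+z. \<integral>\<^sup>+s. ennreal (real ?N) * (indicator {0<..} s * ennreal (s ^ n * (1 / s ^ ?N) * (norm z / s) ^ ?N) *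
        indicator (ball 0 s) z) * h z \<partial>lborel \<partial>(lborel :: 'a measure))"
  proof (rule lborel_pair.Fubini')
    have [measurable]: "(\<lambda>(z, s). indicator (ball 0 s) z :: ennreal) \<in> borel_measurable ((lborel :: 'a measure) \<Otimes>\<^sub>M lborel)"
    proof -
      have "(\<lambda>(z::'a, s). indicator (ball 0 s) z :: ennreal) = indicator {x. norm (fst x) < snd x}"
        by (auto simp: indicator_def fun_eq_iff)
      also have "\<dots> \<in> borel_measurable ((lborel :: 'a measure) \<Otimes>\<^sub>M lborel)" by measurable
      finally show ?thesis .
    qed
    show "(\<lambda>(z, s). ennreal (real ?N) * (indicator {0<..} s * ennreal (s ^ n * (1 / s ^ ?N) * (norm z / s) ^ ?N) *
        indicator (ball 0 s) z) * h z) \<in> borel_measurable ((lborel :: 'a measure) \<Otimes>\<^sub>M lborel)"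
      by measurable
  qed
  also have "\<dots> = (\<integral>\<^sup>+z. h z \<partial>lborel)"
  proof (rule nn_integral_cong_AE, rule AE_mp[OF AE_lborel_singleton[of 0]], rule AE_I2, rule impI)
    fix z :: 'a assume z: "z \<noteq> 0"
    have [measurable]: "(\<lambda>s. indicator (ball 0 s) z :: ennreal) \<in> borel_measurable lborel"
    proof -
      have "(\<lambda>s. indicator (ball 0 s) z :: ennreal) = indicator {s. norm z < s}"
        by (auto simp: indicator_def fun_eq_iff)
      also have "\<dots> \<in> borel_measurable lborel" by measurable
      finally show ?thesis .
    qed
    show "(\<integral>\<^sup>+s. ennreal (real ?N) * (indicator {0<..} s * ennreal (s ^ n * (1 / s ^ ?N) * (norm z / s) ^ ?N) *
        indicator (ball 0 s) z) * h z \<partial>lborel) = h z"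
      by (subst nn_integral_multc) (use tail[OF z] in auto)
  qed
  finally show ?thesis unfolding n_def .
qed

text \<open>By the mean value theorem \<open>w\<close> also bounds the difference quotients, so dominated
convergence applies to them.\<close>

lemma has_real_derivative_lebesgue_integral:
  fixes h h' :: "real \<Rightarrow> 'b \<Rightarrow> real"
  assumes int: "\<And>t. integrable M (h t)"
    and deriv: "\<And>t x. ((\<lambda>t. h t x) has_real_derivative h' t x) (at t)"
    and meas: "h' t0 \<in> borel_measurable M"
    and bound: "AE x in M. \<forall>t. \<bar>t - t0\<bar> < 1 \<longrightarrow> \<bar>h' t x\<bar> \<le> w x"
    and w: "integrable M w"
  shows "((\<lambda>t. \<integral>x. h t x \<partial>M) has_real_derivative (\<integral>x. h' t0 x \<partial>M)) (at t0)"
proof -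
  have "((\<lambda>s. ((\<integral>x. h (t0 + s) x \<partial>M) - (\<integral>x. h t0 x \<partial>M)) / s) \<longlongrightarrow> (\<integral>x. h' t0 x \<partial>M)) (at 0)"
    unfolding tendsto_at_iff_sequentially comp_def
  proof (intro allI impI)
    fix X :: "nat \<Rightarrow> real"
    assume X0: "\<forall>i. X i \<in> UNIV - {0}" and X: "X \<longlonglongrightarrow> 0"
    have "\<forall>\<^sub>F i in sequentially. dist (X i) 0 < 1"
      using X by (rule tendstoD) simp
    then obtain m where m: "\<And>i. i \<ge> m \<Longrightarrow> \<bar>X i\<bar> < 1"
      unfolding eventually_sequentially by auto
    \<comment> \<open>only increments of size less than \<open>1\<close> are controlled, so a tail of the sequence is used\<close>
    define Y where "Y i = X (i + m)" for i
    have Y: "Y \<longlonglongrightarrow> 0" unfolding Y_def using X by (rule LIMSEQ_ignore_initial_segment)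
    have Y0: "Y i \<noteq> 0" and Y1: "\<bar>Y i\<bar> < 1" for i using X0 m by (auto simp: Y_def)
    have lim: "(\<lambda>i. \<integral>x. (h (t0 + Y i) x - h t0 x) / Y i \<partial>M) \<longlonglongrightarrow> (\<integral>x. h' t0 x \<partial>M)"
    proof (rule integral_dominated_convergence[where w=w])
      show "AE x in M. (\<lambda>i. (h (t0 + Y i) x - h t0 x) / Y i) \<longlonglongrightarrow> h' t0 x"
      proof (rule AE_I2)
        fix x
        have "((\<lambda>s. (h (t0 + s) x - h t0 x) / s) \<longlongrightarrow> h' t0 x) (at 0)"
          using deriv[of x t0] by (simp add: DERIV_def)
        then show "(\<lambda>i. (h (t0 + Y i) x - h t0 x) / Y i) \<longlonglongrightarrow> h' t0 x"
          unfolding tendsto_at_iff_sequentially comp_def using Y Y0 by auto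
      qed
      show "AE x in M. norm ((h (t0 + Y i) x - h t0 x) / Y i) \<le> w x" for i
      proof (rule AE_mp[OF bound], rule AE_I2, rule impI)
        fix x assume b: "\<forall>t. \<bar>t - t0\<bar> < 1 \<longrightarrow> \<bar>h' t x\<bar> \<le> w x"
        have "norm (h (t0 + Y i) x - h t0 x) \<le> w x * norm (t0 + Y i - t0)"
        proof (rule field_differentiable_bound[where S="ball t0 1" and f="\<lambda>t. h t x" and f'="\<lambda>t. h' t x"])
          show "((\<lambda>t. h t x) has_field_derivative h' t x) (at t within ball t0 1)" for t
            using deriv by (rule has_field_derivative_at_within)
        qed (use b Y1[of i] in \<open>auto simp: dist_real_def abs_minus_commute\<close>)
        then show "norm ((h (t0 + Y i) x - h t0 x) / Y i) \<le> w x"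
          using Y0[of i] by (simp add: field_simps)
      qed
    qed (use int w meas in auto)
    have eq: "(\<integral>x. (h (t0 + Y i) x - h t0 x) / Y i \<partial>M)
        = ((\<integral>x. h (t0 + Y i) x \<partial>M) - (\<integral>x. h t0 x \<partial>M)) / Y i" for i
      using int by simp
    from lim have "(\<lambda>i. ((\<integral>x. h (t0 + X (i + m)) x \<partial>M) - (\<integral>x. h t0 x \<partial>M)) / X (i + m)) \<longlonglongrightarrow> (\<integral>x. h' t0 x \<partial>M)"
      unfolding eq unfolding Y_def .
    then show "(\<lambda>i. ((\<integral>x. h (t0 + X i) x \<partial>M) - (\<integral>x. h t0 x \<partial>M)) / X i) \<longlonglongrightarrow> (\<integral>x. h' t0 x \<partial>M)"
      by (rule LIMSEQ_offset)
  qed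
  then show ?thesis by (simp add: DERIV_def)
qed

lemma continuous_bounded_on_cball:
  fixes g :: "'a::euclidean_space \<Rightarrow> real"
  assumes "continuous_on UNIV g"
  obtains B where "\<And>x. norm x \<le> R \<Longrightarrow> \<bar>g x\<bar> \<le> B"
proof -
  have "bounded (g ` cball 0 R)"
    using assms by (intro compact_imp_bounded compact_continuous_image) (auto intro: continuous_on_subset)
  then obtain B where "\<forall>y\<in>g ` cball 0 R. norm y \<le> B" unfolding bounded_iff by blast
  then show ?thesis by (intro that[of B]) auto
qed

lemma borel_measurable_continuous_sphere:
  fixes g :: "'a::euclidean_space \<Rightarrow> 'b::topological_space"
  assumes "continuous_on UNIV g"
  shows "g \<in> borel_measurable (sphere_measure x r)"
  using borel_measurable_continuous_onI[OF assms] by (simp cong: measurable_cong_sets)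

lemma integrable_unit_sphere:
  fixes g :: "'a::euclidean_space \<Rightarrow> real"
  assumes "continuous_on UNIV g"
  shows "integrable unit_sphere_measure g"
proof -
  interpret finite_measure "unit_sphere_measure :: 'a measure" by (rule finite_measure_unit_sphere)
  obtain B where B: "\<And>x. norm x \<le> 1 \<Longrightarrow> \<bar>g x\<bar> \<le> B"
    using continuous_bounded_on_cball[OF assms] by blast
  show ?thesis
    by (rule integrable_const_bound[where B=B])
      (use AE_unit_sphere_norm B borel_measurable_continuous_sphere[OF assms] in \<open>auto elim!: eventually_mono\<close>)
qed

lemma integrable_unit_sphere_scaled:
  fixes g :: "'a::euclidean_space \<Rightarrow> real"
  assumes "continuous_on UNIV g"
  shows "integrable unit_sphere_measure (\<lambda>x. g (r *\<^sub>R x))"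
  by (rule integrable_unit_sphere) (intro continuous_on_compose2[OF assms] continuous_intros, simp)

lemma integral_sphere_measure_eq:
  fixes g :: "'a::euclidean_space \<Rightarrow> real"
  assumes "continuous_on UNIV g" and r: "r > 0"
  shows "(\<integral>x. g x \<partial>sphere_measure 0 r) = r ^ (DIM('a) - 1) * (\<integral>x. g (r *\<^sub>R x) \<partial>unit_sphere_measure)"
proof -
  have gm: "g \<in> borel_measurable borel" using assms(1) by (rule borel_measurable_continuous_onI)
  have "sphere_measure 0 r = density (distr unit_sphere_measure borel (\<lambda>x::'a. r *\<^sub>R x)) (\<lambda>_. ennreal (r ^ (DIM('a) - 1)))"
    unfolding sphere_measure_eq_scaled_unit_sphere[OF r]
    by (rule measure_eqI) (auto simp: emeasure_density nn_integral_cmult_indicator)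
  then have "(\<integral>x. g x \<partial>sphere_measure 0 r)
     = (\<integral>x. r ^ (DIM('a) - 1) *\<^sub>R g x \<partial>distr unit_sphere_measure borel (\<lambda>x::'a. r *\<^sub>R x))"
    using r gm by (simp add: integral_density)
  also have "\<dots> = r ^ (DIM('a) - 1) * (\<integral>x. g (r *\<^sub>R x) \<partial>unit_sphere_measure)"
    using gm by (subst integral_distr) auto
  finally show ?thesis .
qed

lemma continuous_on_unit_sphere_integral:
  fixes g :: "'a::euclidean_space \<Rightarrow> real"
  assumes g: "continuous_on UNIV g"
  shows "continuous_on UNIV (\<lambda>r. \<integral>x. g (r *\<^sub>R x) \<partial>unit_sphere_measure)"
  unfolding continuous_on_sequentially comp_def
proof (intro allI ballI impI)
  interpret finite_measure "unit_sphere_measure :: 'a measure" by (rule finite_measure_unit_sphere)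
  fix X :: "nat \<Rightarrow> real" and r assume "(\<forall>n. X n \<in> UNIV) \<and> X \<longlonglongrightarrow> r"
  then have X: "X \<longlonglongrightarrow> r" by simp
  then obtain K where K: "\<And>n. \<bar>X n\<bar> \<le> K"
    using convergent_imp_Bseq[of X] by (auto simp: convergent_def Bseq_def)
  obtain B where B: "\<And>x. norm x \<le> K \<Longrightarrow> \<bar>g x\<bar> \<le> B"
    using continuous_bounded_on_cball[OF g] by blast
  show "(\<lambda>n. \<integral>x. g (X n *\<^sub>R x) \<partial>unit_sphere_measure) \<longlonglongrightarrow> (\<integral>x. g (r *\<^sub>R x) \<partial>unit_sphere_measure)"
  proof (rule integral_dominated_convergence[where w="\<lambda>_. B"])
    show "AE x in unit_sphere_measure. (\<lambda>n. g (X n *\<^sub>R x)) \<longlonglongrightarrow> g (r *\<^sub>R x)"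
      by (intro AE_I2 continuous_on_tendsto_compose[OF g] tendsto_intros X) auto
    show "AE x in unit_sphere_measure. norm (g (X n *\<^sub>R x)) \<le> B" for n
      using AE_unit_sphere_norm by eventually_elim (use B K in auto)
    show "(\<lambda>x. g (t *\<^sub>R x)) \<in> borel_measurable unit_sphere_measure" for t
      using integrable_unit_sphere_scaled[OF g] by blast
    then show "(\<lambda>x. g (X n *\<^sub>R x)) \<in> borel_measurable unit_sphere_measure" for n .
  qed simp
qed

lemma set_integrable_ball:
  fixes g :: "'a::euclidean_space \<Rightarrow> real"
  assumes "continuous_on UNIV g"
  shows "set_integrable lborel (ball 0 r) g"
proof -
  have "set_integrable lborel (cball 0 r) g"
    unfolding set_integrable_def using assms
    by (intro borel_integrable_compact) (auto intro: continuous_on_subset)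
  then show ?thesis by (rule set_integrable_subset) auto
qed

text \<open>Nonnegativity is what allows the identity to be transferred from the Lebesgue integral of
extended nonnegative functions; the general case then follows by splitting the integrand.\<close>

lemma nonneg_ball_integral_polar:
  fixes g :: "'a::euclidean_space \<Rightarrow> real"
  assumes g: "continuous_on UNIV g" and nonneg: "\<And>x. g x \<ge> 0" and R: "R > 0"
  shows "(LINT x:ball 0 R|lborel. g x)
    = integral {0..R} (\<lambda>r. r ^ (DIM('a) - 1) * (\<integral>x. g (r *\<^sub>R x) \<partial>unit_sphere_measure))"
proof -
  let ?S = "\<lambda>r. r ^ (DIM('a) - 1) * (\<integral>x. g (r *\<^sub>R x) \<partial>unit_sphere_measure)"
  have [measurable]: "g \<in> borel_measurable borel" "ball (0::'a) R \<in> sets borel"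
    using g by (auto intro: borel_measurable_continuous_onI)
  have contS: "continuous_on A ?S" for A
    by (intro continuous_intros continuous_on_subset[OF continuous_on_unit_sphere_integral[OF g]]) simp
  have Spos: "?S r \<ge> 0" if "r \<ge> 0" for r
    using that nonneg by (intro mult_nonneg_nonneg integral_nonneg_AE) auto
  have "ennreal (LINT x:ball 0 R|lborel. g x) = (\<integral>\<^sup>+x. ennreal (indicator (ball 0 R) x * g x) \<partial>lborel)"
    unfolding set_lebesgue_integral_def
    using set_integrable_ball[OF g, of R] nonneg
    by (subst nn_integral_eq_integral) (auto simp: set_integrable_def)
  also have "\<dots> = (\<integral>\<^sup>+\<rho>. indicator {0<..} \<rho> * ennreal (\<rho> ^ (DIM('a) - 1)) *
      (\<integral>\<^sup>+x. ennreal (indicator (ball 0 R) (\<rho> *\<^sub>R x) * g (\<rho> *\<^sub>R x)) \<partial>unit_sphere_measure) \<partial>lborel)"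
    by (rule nn_integral_polar[symmetric]) measurable
  also have "\<dots> = (\<integral>\<^sup>+\<rho>. ennreal (indicator {0..R} \<rho> *\<^sub>R ?S \<rho>) \<partial>lborel)"
  proof (rule nn_integral_cong_AE, rule AE_mp[OF AE_lborel_singleton[of 0]],
      rule AE_mp[OF AE_lborel_singleton[of R]], rule AE_I2, intro impI)
    fix \<rho> :: real assume ne: "\<rho> \<noteq> R" "\<rho> \<noteq> 0"
    show "indicator {0<..} \<rho> * ennreal (\<rho> ^ (DIM('a) - 1)) *
      (\<integral>\<^sup>+x. ennreal (indicator (ball 0 R) (\<rho> *\<^sub>R x) * g (\<rho> *\<^sub>R x)) \<partial>unit_sphere_measure)
      = ennreal (indicator {0..R} \<rho> *\<^sub>R ?S \<rho>)"
    proof (cases "\<rho> > 0")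
      case True
      have "(\<integral>\<^sup>+x. ennreal (indicator (ball 0 R) (\<rho> *\<^sub>R x) * g (\<rho> *\<^sub>R x)) \<partial>unit_sphere_measure)
        = (\<integral>\<^sup>+x. indicator {..<R} \<rho> * ennreal (g (\<rho> *\<^sub>R x)) \<partial>unit_sphere_measure)"
        by (rule nn_integral_cong_AE, rule AE_mp[OF AE_unit_sphere_norm], rule AE_I2)
          (use True in \<open>auto simp: indicator_def\<close>)
      also have "\<dots> = indicator {..<R} \<rho> * (\<integral>\<^sup>+x. ennreal (g (\<rho> *\<^sub>R x)) \<partial>unit_sphere_measure)"
        by (rule nn_integral_cmult) (simp cong: measurable_cong_sets)
      also have "(\<integral>\<^sup>+x. ennreal (g (\<rho> *\<^sub>R x)) \<partial>unit_sphere_measure)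
          = ennreal (\<integral>x. g (\<rho> *\<^sub>R x) \<partial>unit_sphere_measure)"
        by (rule nn_integral_eq_integral) (use nonneg integrable_unit_sphere_scaled[OF g] in auto)
      finally show ?thesis using True ne
        by (auto simp: indicator_def ennreal_mult')
    qed (use ne in auto)
  qed
  also have "\<dots> = ennreal (\<integral>\<rho>. indicator {0..R} \<rho> *\<^sub>R ?S \<rho> \<partial>lborel)"
    by (rule nn_integral_eq_integral, intro borel_integrable_compact contS)
      (use Spos in \<open>auto simp: indicator_def\<close>)
  also have "(\<integral>\<rho>. indicator {0..R} \<rho> *\<^sub>R ?S \<rho> \<partial>lborel) = integral {0..R} ?S"
    unfolding set_lebesgue_integral_def[symmetric]
    by (rule set_borel_integral_eq_integral(2), unfold set_integrable_def, intro borel_integrable_compact contS) simp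
  finally have "ennreal (LINT x:ball 0 R|lborel. g x) = ennreal (integral {0..R} ?S)" .
  moreover have "(LINT x:ball 0 R|lborel. g x) \<ge> 0"
    unfolding set_lebesgue_integral_def by (rule integral_nonneg_AE) (use nonneg in auto)
  moreover have "integral {0..R} ?S \<ge> 0"
    by (rule integral_nonneg) (use contS Spos in \<open>auto intro: integrable_continuous_real\<close>)
  ultimately show ?thesis by simp
qed

lemma ball_integral_polar:
  fixes g :: "'a::euclidean_space \<Rightarrow> real"
  assumes g: "continuous_on UNIV g" and R: "R > 0"
  shows "(LINT x:ball 0 R|lborel. g x)
    = integral {0..R} (\<lambda>r. r ^ (DIM('a) - 1) * (\<integral>x. g (r *\<^sub>R x) \<partial>unit_sphere_measure))"
proof -
  define p m where "p x = max (g x) 0" and "m x = max (- g x) 0" for x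
  have p: "continuous_on UNIV p" and m: "continuous_on UNIV m"
    unfolding p_def m_def by (intro continuous_intros g)+
  have gpm: "g = (\<lambda>x. p x - m x)" by (auto simp: p_def m_def)
  have *: "(\<lambda>r. r ^ (DIM('a) - 1) * (\<integral>x. f (r *\<^sub>R x) \<partial>unit_sphere_measure)) integrable_on {0..R}"
    if "continuous_on UNIV f" for f :: "'a \<Rightarrow> real"
    by (intro integrable_continuous_real continuous_intros
        continuous_on_subset[OF continuous_on_unit_sphere_integral[OF that]]) simp
  have "(LINT x:ball 0 R|lborel. g x) = (LINT x:ball 0 R|lborel. p x) - (LINT x:ball 0 R|lborel. m x)"
    unfolding gpm by (intro set_integral_diff set_integrable_ball p m)
  also have "\<dots> = integral {0..R} (\<lambda>r. r ^ (DIM('a) - 1) * (\<integral>x. p (r *\<^sub>R x) \<partial>unit_sphere_measure))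
     - integral {0..R} (\<lambda>r. r ^ (DIM('a) - 1) * (\<integral>x. m (r *\<^sub>R x) \<partial>unit_sphere_measure))"
    by (subst (1 2) nonneg_ball_integral_polar) (use p m R in \<open>auto simp: p_def m_def\<close>)
  also have "\<dots> = integral {0..R} (\<lambda>r. r ^ (DIM('a) - 1) * (\<integral>x. p (r *\<^sub>R x) \<partial>unit_sphere_measure)
     - r ^ (DIM('a) - 1) * (\<integral>x. m (r *\<^sub>R x) \<partial>unit_sphere_measure))"
    by (intro integral_diff[symmetric] * p m)
  also have "\<dots> = integral {0..R} (\<lambda>r. r ^ (DIM('a) - 1) * (\<integral>x. g (r *\<^sub>R x) \<partial>unit_sphere_measure))"
    unfolding gpm by (simp add: integrable_unit_sphere_scaled p m right_diff_distrib)
  finally show ?thesis .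
qed

lemma has_real_derivative_ball_integral:
  fixes g :: "'a::euclidean_space \<Rightarrow> real"
  assumes g: "continuous_on UNIV g" and R: "R > 0"
  shows "((\<lambda>r. LINT x:ball 0 r|lborel. g x) has_real_derivative
     R ^ (DIM('a) - 1) * (\<integral>x. g (R *\<^sub>R x) \<partial>unit_sphere_measure)) (at R)"
proof -
  let ?S = "\<lambda>r. r ^ (DIM('a) - 1) * (\<integral>x. g (r *\<^sub>R x) \<partial>unit_sphere_measure)"
  have "((\<lambda>r. integral {0..r} ?S) has_real_derivative ?S R) (at R within {0..R + 1})"
    by (rule integral_has_real_derivative)
      (use R in \<open>auto intro!: continuous_intros continuous_on_subset[OF continuous_on_unit_sphere_integral[OF g]]\<close>)
  then have "((\<lambda>r. integral {0..r} ?S) has_real_derivative ?S R) (at R)"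
    using R by (simp add: at_within_Icc_at)
  then show ?thesis
    by (rule has_field_derivative_transform_within_open[where S="{0<..}"])
      (use R in \<open>auto simp: ball_integral_polar[OF g]\<close>)
qed

lemma ball_integral_pos:
  fixes g :: "'a::euclidean_space \<Rightarrow> real"
  assumes g: "continuous_on UNIV g" and nonneg: "\<And>x. g x \<ge> 0" and x: "norm x < R" "g x > 0"
  shows "(LINT x:ball 0 R|lborel. g x) > 0"
proof -
  have int: "integrable lborel (\<lambda>x. indicator (ball 0 R) x *\<^sub>R g x)"
    using set_integrable_ball[OF g] by (simp add: set_integrable_def)
  have "(LINT x:ball 0 R|lborel. g x) \<noteq> 0"
  proof
    assume "(LINT x:ball 0 R|lborel. g x) = 0"
    then have ae: "AE x in lborel. indicator (ball 0 R) x *\<^sub>R g x = 0"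
      using integral_nonneg_eq_0_iff_AE[OF int] nonneg by (simp add: set_lebesgue_integral_def)
    have "open ({y. g y > 0} \<inter> ball 0 R)"
      using g by (intro open_Int open_Collect_less continuous_on_const) auto
    then obtain e where e: "e > 0" "ball x e \<subseteq> {y. g y > 0} \<inter> ball 0 R"
      using x by (metis (no_types, lifting) IntI mem_Collect_eq mem_ball_0 open_contains_ball)
    have "AE y in lborel. y \<notin> ball x e"
      using ae by eventually_elim (use e(2) in \<open>auto simp: indicator_def split: if_splits\<close>)
    then have "emeasure lborel (ball x e) = 0"
      by (subst (asm) AE_iff_null_sets[symmetric]) auto
    then show False using content_ball_pos[OF e(1), of x] by (simp add: measure_def)
  qed
  moreover have "(LINT x:ball 0 R|lborel. g x) \<ge> 0"
    unfolding set_lebesgue_integral_def by (rule integral_nonneg_AE) (use nonneg in auto)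
  ultimately show ?thesis by simp
qed

text \<open>Rescaling to the unit sphere has moved the radius into the integrand, where it can be
differentiated under the integral sign.\<close>

lemma has_real_derivative_unit_sphere_integral:
  fixes f :: "'a::euclidean_space \<Rightarrow> real"
  assumes deriv: "\<And>x. (f has_derivative (\<lambda>v. G x \<bullet> v)) (at x)" and cont: "continuous_on UNIV G"
  shows "((\<lambda>r. \<integral>x. f (r *\<^sub>R x) \<partial>unit_sphere_measure) has_real_derivative
    (\<integral>x. G (r *\<^sub>R x) \<bullet> x \<partial>unit_sphere_measure)) (at r)"
proof -
  interpret finite_measure "unit_sphere_measure :: 'a measure" by (rule finite_measure_unit_sphere)
  have contf: "continuous_on UNIV f"
    using deriv by (meson continuous_at_imp_continuous_on has_derivative_continuous)
  obtain K where K: "\<And>x. norm x \<le> \<bar>r\<bar> + 1 \<Longrightarrow> \<bar>norm (G x)\<bar> \<le> K"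
    using continuous_bounded_on_cball[of "\<lambda>x. norm (G x)"] cont by (metis continuous_on_norm)
  show ?thesis
  proof (rule has_real_derivative_lebesgue_integral[where w="\<lambda>_. K"])
    show "integrable unit_sphere_measure (\<lambda>x. f (t *\<^sub>R x))" for t
      by (rule integrable_unit_sphere_scaled[OF contf])
    show "((\<lambda>t. f (t *\<^sub>R x)) has_real_derivative G (t *\<^sub>R x) \<bullet> x) (at t)" for t x
    proof -
      have "((\<lambda>t. t *\<^sub>R x) has_derivative (\<lambda>t. t *\<^sub>R x)) (at t)"
        by (auto intro!: derivative_eq_intros)
      then have "((\<lambda>t. f (t *\<^sub>R x)) has_derivative (\<lambda>s. G (t *\<^sub>R x) \<bullet> (s *\<^sub>R x))) (at t)"
        using has_derivative_compose[of "\<lambda>t. t *\<^sub>R x" _ t UNIV f] deriv by blast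
      moreover have "(\<lambda>s. G (t *\<^sub>R x) \<bullet> (s *\<^sub>R x)) = (*) (G (t *\<^sub>R x) \<bullet> x)" by (auto simp: fun_eq_iff)
      ultimately show ?thesis unfolding has_field_derivative_def by simp
    qed
    have "continuous_on UNIV (\<lambda>x. G (r *\<^sub>R x))"
      by (rule continuous_on_compose2[OF cont]) (auto intro: continuous_intros)
    then show "(\<lambda>x. G (r *\<^sub>R x) \<bullet> x) \<in> borel_measurable unit_sphere_measure"
      by (intro borel_measurable_continuous_sphere continuous_intros)
    show "AE x in unit_sphere_measure. \<forall>t. \<bar>t - r\<bar> < 1 \<longrightarrow> \<bar>G (t *\<^sub>R x) \<bullet> x\<bar> \<le> K"
      using AE_unit_sphere_norm
    proof eventually_elim
      case (elim x)
      show ?case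
      proof (intro allI impI)
        fix t assume t: "\<bar>t - r\<bar> < 1"
        have "\<bar>G (t *\<^sub>R x) \<bullet> x\<bar> \<le> norm (G (t *\<^sub>R x)) * norm x" by (rule Cauchy_Schwarz_ineq2)
        also have "\<dots> \<le> K" using K[of "t *\<^sub>R x"] t elim by simp
        finally show "\<bar>G (t *\<^sub>R x) \<bullet> x\<bar> \<le> K" .
      qed
    qed
  qed simp
qed

section \<open>The divergence theorem on balls\<close>

text \<open>The integral of \<open>\<lambda>x. \<psi> (x + t v)\<close> does not depend on \<open>t\<close>, so its derivative at \<open>t = 0\<close> vanishes. This
is the only source of integration by parts in what follows.\<close>

lemma integral_directional_deriv_compact_support:
  fixes \<psi> \<psi>' :: "'a::euclidean_space \<Rightarrow> real"
  assumes deriv: "\<And>x. ((\<lambda>t. \<psi> (x + t *\<^sub>R v)) has_real_derivative \<psi>' x) (at 0)"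
    and cont: "continuous_on UNIV \<psi>" and cont': "continuous_on UNIV \<psi>'"
    and supp: "\<And>x. norm x \<ge> R \<Longrightarrow> \<psi> x = 0" and supp': "\<And>x. norm x \<ge> R \<Longrightarrow> \<psi>' x = 0"
  shows "(\<integral>x. \<psi>' x \<partial>lborel) = 0"
proof -
  have int: "integrable lborel \<psi>"
  proof -
    have "integrable lborel (\<lambda>x. indicator (cball 0 R) x *\<^sub>R \<psi> x)"
      by (rule borel_integrable_compact) (use cont in \<open>auto intro: continuous_on_subset\<close>)
    moreover have "(\<lambda>x. indicator (cball 0 R) x *\<^sub>R \<psi> x) = \<psi>"
      using supp by (auto simp: indicator_def fun_eq_iff)
    ultimately show ?thesis by simp
  qed
  have trans: "lborel = distr lborel borel ((+) (c :: 'a))" for c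
    by (simp add: lborel_distr_plus)
  have shift: "integrable lborel (\<lambda>x. \<psi> (x + c)) \<and> (\<integral>x. \<psi> (x + c) \<partial>lborel) = (\<integral>x. \<psi> x \<partial>lborel)" for c
  proof -
    have [measurable]: "\<psi> \<in> borel_measurable borel" using cont by (rule borel_measurable_continuous_onI)
    have "integrable (distr lborel borel ((+) c)) \<psi>" using int trans[of c] by simp
    moreover have "(\<integral>x. \<psi> x \<partial>lborel) = (\<integral>x. \<psi> x \<partial>distr lborel borel ((+) c))" using trans[of c] by simp
    ultimately show ?thesis by (simp add: integrable_distr_eq integral_distr add.commute)
  qed
  obtain B where B: "\<And>x. norm x \<le> R \<Longrightarrow> \<bar>\<psi>' x\<bar> \<le> B"
    using continuous_bounded_on_cball[OF cont'] by blast
  define S where "S = R + norm v"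
  have "((\<lambda>t. \<integral>x. \<psi> (x + t *\<^sub>R v) \<partial>lborel) has_real_derivative (\<integral>x. \<psi>' (x + 0 *\<^sub>R v) \<partial>lborel)) (at 0)"
  proof (rule has_real_derivative_lebesgue_integral[where w="\<lambda>x. indicator (cball 0 S) x * \<bar>B\<bar>"])
    show "((\<lambda>t. \<psi> (x + t *\<^sub>R v)) has_real_derivative \<psi>' (x + t *\<^sub>R v)) (at t)" for x t
      using deriv[of "x + t *\<^sub>R v"]
        DERIV_shift[of "\<lambda>t. \<psi> (x + t *\<^sub>R v)" "\<psi>' (x + t *\<^sub>R v)" 0 t]
      by (simp add: algebra_simps)
    show "AE x in lborel. \<forall>t. \<bar>t - 0\<bar> < 1 \<longrightarrow> \<bar>\<psi>' (x + t *\<^sub>R v)\<bar> \<le> indicator (cball 0 S) x * \<bar>B\<bar>"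
    proof (intro AE_I2 allI impI)
      fix x :: 'a and t :: real assume t: "\<bar>t - 0\<bar> < 1"
      show "\<bar>\<psi>' (x + t *\<^sub>R v)\<bar> \<le> indicator (cball 0 S) x * \<bar>B\<bar>"
      proof (cases "norm (x + t *\<^sub>R v) < R")
        case True
        have "norm x \<le> norm (x + t *\<^sub>R v) + norm (t *\<^sub>R v)"
          by (metis add_diff_cancel_right' norm_triangle_ineq4)
        also have "norm (t *\<^sub>R v) \<le> norm v" using t by (simp add: mult_left_le_one_le)
        finally have "x \<in> cball 0 S" using True by (simp add: S_def)
        then show ?thesis using B[of "x + t *\<^sub>R v"] True by simp
      qed (use supp' in auto)
    qed
    show "(\<lambda>x. \<psi>' (x + 0 *\<^sub>R v)) \<in> borel_measurable lborel"
      using borel_measurable_continuous_onI[OF cont'] by simp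
    show "integrable lborel (\<lambda>x::'a. indicator (cball 0 S) x * \<bar>B\<bar>)"
      using borel_integrable_compact[of "cball (0::'a) S" "\<lambda>_. \<bar>B\<bar>"] by simp
  qed (use shift in auto)
  moreover have "((\<lambda>t. \<integral>x. \<psi> (x + t *\<^sub>R v) \<partial>lborel) has_real_derivative 0) (at 0)"
    using shift by simp
  ultimately have "(\<integral>x. \<psi>' (x + 0 *\<^sub>R v) \<partial>lborel) = 0" by (rule DERIV_unique)
  then show ?thesis by simp
qed

lemma has_real_derivative_pos_part_square:
  "((\<lambda>s::real. (max 0 s)\<^sup>2) has_real_derivative 2 * max 0 s) (at s)"
proof (cases s "0::real" rule: linorder_cases)
  case less
  have "((\<lambda>s::real. (max 0 s)\<^sup>2) has_real_derivative 0) (at s)"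
    by (rule has_field_derivative_transform_within_open[OF DERIV_const open_lessThan[of 0]]) (use less in auto)
  then show ?thesis using less by simp
next
  case greater
  have "((\<lambda>s::real. s\<^sup>2) has_real_derivative 2 * s) (at s)" by (auto intro!: derivative_eq_intros)
  then have "((\<lambda>s::real. (max 0 s)\<^sup>2) has_real_derivative 2 * s) (at s)"
    by (rule has_field_derivative_transform_within_open[OF _ open_greaterThan[of 0]]) (use greater in auto)
  then show ?thesis using greater by simp
next
  case equal
  have "((\<lambda>h::real. (max 0 h)\<^sup>2 / h) \<longlongrightarrow> 0) (at 0)"
  proof (rule Lim_null_comparison[where g="\<lambda>h. \<bar>h\<bar>"])
    show "\<forall>\<^sub>F h in at (0::real). norm ((max 0 h)\<^sup>2 / h) \<le> \<bar>h\<bar>"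
      by (rule always_eventually) (auto simp: max_def power2_eq_square)
    show "((\<lambda>h::real. \<bar>h\<bar>) \<longlongrightarrow> 0) (at 0)" by (rule tendsto_rabs_zero) (rule tendsto_ident_at)
  qed
  then show ?thesis using equal by (simp add: DERIV_def)
qed

text \<open>The divergence theorem tested with the cutoff \<open>(max 0 (R\<^sup>2 - |x|\<^sup>2))\<^sup>2\<close>. The square makes it continuously
differentiable across the sphere, with gradient \<open>-4 (R\<^sup>2 - |x|\<^sup>2) x\<close> inside the ball.\<close>

lemma ball_integral_weighted_divergence:
  fixes F :: "'a::euclidean_space \<Rightarrow> 'a"
  assumes deriv: "\<And>x. (F has_derivative F' x) (at x)"
    and cont: "\<And>b. b \<in> Basis \<Longrightarrow> continuous_on UNIV (\<lambda>x. F' x b)" and R: "R > 0"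
  shows "(LINT x:ball 0 R|lborel. (R\<^sup>2 - (norm x)\<^sup>2)\<^sup>2 * (\<Sum>b\<in>Basis. F' x b \<bullet> b))
    = 4 * (LINT x:ball 0 R|lborel. (R\<^sup>2 - (norm x)\<^sup>2) * (F x \<bullet> x))"
proof -
  define m where "m x = max 0 (R\<^sup>2 - (norm x)\<^sup>2)" for x :: 'a
  have contF: "continuous_on UNIV F"
    using deriv by (meson continuous_at_imp_continuous_on has_derivative_continuous)
  have contm: "continuous_on UNIV m" unfolding m_def by (intro continuous_intros)
  have m0: "m x = 0" if "norm x \<ge> R" for x
    using that R power_mono[of R "norm x" 2] by (simp add: m_def)
  define \<psi> where "\<psi> b x = (m x)\<^sup>2 * (F x \<bullet> b)" for b x
  define \<psi>' where "\<psi>' b x = (m x)\<^sup>2 * (F' x b \<bullet> b) - 4 * m x * (x \<bullet> b) * (F x \<bullet> b)" for b x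
  have zero: "(\<integral>x. \<psi>' b x \<partial>lborel) = 0" if b: "b \<in> Basis" for b
  proof (rule integral_directional_deriv_compact_support[where \<psi>="\<psi> b" and v=b and R=R])
    fix x
    have n: "((\<lambda>t. R\<^sup>2 - (norm (x + t *\<^sub>R b))\<^sup>2) has_real_derivative - 2 * (x \<bullet> b)) (at 0)"
      unfolding power2_norm_eq_inner inner_simps
      by (auto intro!: derivative_eq_intros simp: inner_commute)
    have d1: "((\<lambda>t. (m (x + t *\<^sub>R b))\<^sup>2) has_real_derivative (2 * m x) * (- 2 * (x \<bullet> b))) (at 0)"
      using DERIV_chain'[OF n has_real_derivative_pos_part_square] by (simp add: m_def)
    have "((\<lambda>t. x + t *\<^sub>R b) has_derivative (\<lambda>t. t *\<^sub>R b)) (at 0)"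
      by (auto intro!: derivative_eq_intros)
    then have "((\<lambda>t. F (x + t *\<^sub>R b)) has_derivative (\<lambda>t. F' x (t *\<^sub>R b))) (at 0)"
      using has_derivative_compose[of "\<lambda>t. x + t *\<^sub>R b" _ 0 UNIV F "F' x"] deriv[of x] by simp
    then have "((\<lambda>t. F (x + t *\<^sub>R b) \<bullet> b) has_derivative (\<lambda>t. F' x (t *\<^sub>R b) \<bullet> b)) (at 0)"
      by (rule has_derivative_inner_left)
    moreover have "(\<lambda>t. F' x (t *\<^sub>R b) \<bullet> b) = (*) (F' x b \<bullet> b)"
      using linear_scale[OF has_derivative_linear[OF deriv[of x]]] by (auto simp: fun_eq_iff)
    ultimately have d2: "((\<lambda>t. F (x + t *\<^sub>R b) \<bullet> b) has_real_derivative F' x b \<bullet> b) (at 0)"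
      by (simp add: has_field_derivative_def)
    show "((\<lambda>t. \<psi> b (x + t *\<^sub>R b)) has_real_derivative \<psi>' b x) (at 0)"
      unfolding \<psi>_def by (rule DERIV_cong[OF DERIV_mult[OF d1 d2]]) (simp add: \<psi>'_def algebra_simps)
  qed (use b m0 in \<open>auto simp: \<psi>_def \<psi>'_def intro!: continuous_intros contF contm cont\<close>)
  have int: "integrable lborel (\<lambda>x. \<psi>' b x)" if b: "b \<in> Basis" for b
  proof -
    have "integrable lborel (\<lambda>x. indicator (cball 0 R) x *\<^sub>R \<psi>' b x)" unfolding \<psi>'_def
      by (rule borel_integrable_compact)
        (auto intro!: continuous_intros continuous_on_subset[OF contF] continuous_on_subset[OF contm]
           continuous_on_subset[OF cont] b)
    moreover have "(\<lambda>x. indicator (cball 0 R) x *\<^sub>R \<psi>' b x) = \<psi>' b"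
      using m0 by (auto simp: indicator_def fun_eq_iff \<psi>'_def)
    ultimately show ?thesis by simp
  qed
  define d where "d x = (R\<^sup>2 - (norm x)\<^sup>2)\<^sup>2 * (\<Sum>b\<in>Basis. F' x b \<bullet> b)" for x
  define e where "e x = (R\<^sup>2 - (norm x)\<^sup>2) * (F x \<bullet> x)" for x
  have contd: "continuous_on UNIV d" and conte: "continuous_on UNIV e"
    unfolding d_def e_def by (intro continuous_intros cont contF; assumption)+
  have "(\<Sum>b\<in>Basis. \<psi>' b x) = indicator (ball 0 R) x * (d x - 4 * e x)" for x
  proof (cases "norm x < R")
    case True
    then have "(norm x)\<^sup>2 \<le> R\<^sup>2" by (intro power_mono) auto
    then have "m x = R\<^sup>2 - (norm x)\<^sup>2" by (simp add: m_def)
    moreover have "F x \<bullet> x = (\<Sum>b\<in>Basis. (x \<bullet> b) * (F x \<bullet> b))"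
      by (subst euclidean_inner) (simp add: mult.commute)
    moreover have "(\<Sum>b\<in>Basis. \<psi>' b x) = (m x)\<^sup>2 * (\<Sum>b\<in>Basis. F' x b \<bullet> b)
        - 4 * (m x * (\<Sum>b\<in>Basis. (x \<bullet> b) * (F x \<bullet> b)))"
      by (simp add: \<psi>'_def sum_subtractf sum_distrib_left mult.assoc)
    ultimately show ?thesis using True by (simp add: d_def e_def)
  qed (use m0 in \<open>auto simp: \<psi>'_def\<close>)
  then have "(LINT x:ball 0 R|lborel. d x - 4 * e x) = (\<integral>x. (\<Sum>b\<in>Basis. \<psi>' b x) \<partial>lborel)"
    by (simp add: set_lebesgue_integral_def)
  also have "\<dots> = 0" using zero int by (subst Bochner_Integration.integral_sum) auto
  also have "(LINT x:ball 0 R|lborel. d x - 4 * e x)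
      = (LINT x:ball 0 R|lborel. d x) - 4 * (LINT x:ball 0 R|lborel. e x)"
    by (subst set_integral_diff(2), (intro set_integrable_ball continuous_intros contd conte)+)
      (simp only: set_integral_mult_right)
  finally show ?thesis by (simp add: d_def e_def)
qed

text \<open>The weights are removed by differentiating the weighted identity in the radius. Its coefficients
are powers of \<open>r\<close> and ball integrals of \<open>|x|\<^bsup>j\<^esup> g\<close>; by polar coordinates the latter have the derivatives
\<open>r\<^bsup>j\<^esup> S\<close> with a common spherical term \<open>S\<close>. As \<open>(r\<^sup>2 - |x|\<^sup>2)\<^sup>2\<close> vanishes to second order on the
sphere, two differentiations produce no spherical term on the left-hand side. On the right-hand
side \<open>r\<^sup>2 - |x|\<^sup>2\<close> vanishes only to first order, and the second differentiation yields the
boundary integral.\<close>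

theorem divergence_theorem_ball:
  fixes F :: "'a::euclidean_space \<Rightarrow> 'a"
  assumes deriv: "\<And>x. (F has_derivative F' x) (at x)"
    and cont: "\<And>b. b \<in> Basis \<Longrightarrow> continuous_on UNIV (\<lambda>x. F' x b)" and r: "r > 0"
  shows "(LINT x:ball 0 r|lborel. (\<Sum>b\<in>Basis. F' x b \<bullet> b))
    = r ^ (DIM('a) - 1) * (\<integral>x. F (r *\<^sub>R x) \<bullet> x \<partial>unit_sphere_measure)"
proof -
  define n where "n = DIM('a) - 1"
  define d where "d x = (\<Sum>b\<in>Basis. F' x b \<bullet> b)" for x
  define e where "e x = F x \<bullet> x" for x
  have contF: "continuous_on UNIV F"
    using deriv by (meson continuous_at_imp_continuous_on has_derivative_continuous)
  have contd: "continuous_on UNIV d" and conte: "continuous_on UNIV e"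
    unfolding d_def e_def by (intro continuous_intros cont contF; assumption)+
  define I where "I j g r = (LINT x:ball 0 r|lborel. (norm x) ^ j * g x)" for j :: nat and g :: "'a \<Rightarrow> real" and r
  define S where "S g r = r ^ n * (\<integral>x. g (r *\<^sub>R x) \<partial>unit_sphere_measure)" for g :: "'a \<Rightarrow> real" and r :: real
  have D: "((\<lambda>r. I j g r) has_real_derivative r ^ j * S g r) (at r)"
    if "r > 0" "continuous_on UNIV g" for j g r
  proof -
    have "((\<lambda>r. I j g r) has_real_derivative
        r ^ n * (\<integral>x. norm (r *\<^sub>R x) ^ j * g (r *\<^sub>R x) \<partial>unit_sphere_measure)) (at r)"
      unfolding I_def n_def by (rule has_real_derivative_ball_integral) (use that in \<open>auto intro!: continuous_intros\<close>)
    also have "(\<integral>x. norm (r *\<^sub>R x) ^ j * g (r *\<^sub>R x) \<partial>unit_sphere_measure)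
       = (\<integral>x. r ^ j * g (r *\<^sub>R x) \<partial>unit_sphere_measure)"
    proof (rule integral_cong_AE)
      have gr: "continuous_on UNIV (\<lambda>x. g (r *\<^sub>R x))"
        by (rule continuous_on_compose2[OF that(2)]) (auto intro: continuous_intros)
      show "AE x in unit_sphere_measure. norm (r *\<^sub>R x) ^ j * g (r *\<^sub>R x) = r ^ j * g (r *\<^sub>R x)"
        using AE_unit_sphere_norm by eventually_elim (use that in simp)
      show "(\<lambda>x. norm (r *\<^sub>R x) ^ j * g (r *\<^sub>R x)) \<in> borel_measurable unit_sphere_measure"
        "(\<lambda>x. r ^ j * g (r *\<^sub>R x)) \<in> borel_measurable unit_sphere_measure"
        by (intro borel_measurable_continuous_sphere continuous_intros gr)+
    qed
    finally show ?thesis by (simp add: S_def mult_ac)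
  qed
  have lin: "(LINT x:ball 0 r|lborel. (a + b * norm x ^ 2 + c * norm x ^ 4) * g x) = a * I 0 g r + b * I 2 g r + c * I 4 g r"
    if g: "continuous_on UNIV g" for a b c r g
  proof -
    have i: "set_integrable lborel (ball 0 r) (\<lambda>x. norm x ^ j * g x)" for j
      by (intro set_integrable_ball continuous_intros g)
    have eq: "(\<lambda>x. (a + b * norm x ^ 2 + c * norm x ^ 4) * g x)
       = (\<lambda>x. a * (norm x ^ 0 * g x) + b * (norm x ^ 2 * g x) + c * (norm x ^ 4 * g x))"
      by (simp add: algebra_simps)
    have "(LINT x:ball 0 r|lborel. (a + b * norm x ^ 2 + c * norm x ^ 4) * g x)
       = (LINT x:ball 0 r|lborel. a * (norm x ^ 0 * g x) + b * (norm x ^ 2 * g x)) + (LINT x:ball 0 r|lborel. c * (norm x ^ 4 * g x))"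
      unfolding eq by (intro set_integral_add set_integrable_mult_right i)
    also have "(LINT x:ball 0 r|lborel. a * (norm x ^ 0 * g x) + b * (norm x ^ 2 * g x))
       = (LINT x:ball 0 r|lborel. a * (norm x ^ 0 * g x)) + (LINT x:ball 0 r|lborel. b * (norm x ^ 2 * g x))"
      by (intro set_integral_add set_integrable_mult_right i)
    finally show ?thesis unfolding I_def by (simp only: set_integral_mult_right)
  qed
  have eq0: "r ^ 4 * I 0 d r - 2 * r ^ 2 * I 2 d r + I 4 d r = 4 * (r ^ 2 * I 0 e r - I 2 e r)"
    if "r > 0" for r
  proof -
    have "(LINT x:ball 0 r|lborel. (r ^ 4 + (- 2 * r ^ 2) * norm x ^ 2 + 1 * norm x ^ 4) * d x)
       = 4 * (LINT x:ball 0 r|lborel. (r ^ 2 + (- 1) * norm x ^ 2 + 0 * norm x ^ 4) * e x)"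
    proof -
      have 1: "(r ^ 4 + (- 2 * r ^ 2) * norm x ^ 2 + 1 * norm x ^ 4) * d x = (r\<^sup>2 - (norm x)\<^sup>2)\<^sup>2 * d x"
        and 2: "(r ^ 2 + (- 1) * norm x ^ 2 + 0 * norm x ^ 4) * e x = (r\<^sup>2 - (norm x)\<^sup>2) * e x" for x
        by (simp_all add: power2_diff)
      show ?thesis unfolding 1 2 unfolding d_def e_def
        by (rule ball_integral_weighted_divergence[OF deriv cont that])
    qed
    then show ?thesis unfolding lin[OF contd] lin[OF conte] by simp
  qed
  have eq1: "r ^ 2 * I 0 d r - I 2 d r = 2 * I 0 e r" if r: "r > 0" for r
  proof -
    have "((\<lambda>r. r ^ 4 * I 0 d r - 2 * r ^ 2 * I 2 d r + I 4 d r) has_real_derivative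
        (4 * r ^ 3 * I 0 d r - 4 * r * I 2 d r)) (at r)"
      by (rule DERIV_cong, (rule derivative_intros D[OF r contd])+) (simp add: algebra_simps eval_nat_numeral)
    moreover have "((\<lambda>r. 4 * (r ^ 2 * I 0 e r - I 2 e r)) has_real_derivative 8 * r * I 0 e r) (at r)"
      by (rule DERIV_cong, (rule derivative_intros D[OF r conte])+) (simp add: algebra_simps eval_nat_numeral)
    then have "((\<lambda>r. r ^ 4 * I 0 d r - 2 * r ^ 2 * I 2 d r + I 4 d r) has_real_derivative 8 * r * I 0 e r) (at r)"
      by (rule has_field_derivative_transform_within_open[where S="{0<..}"]) (use r eq0 in auto)
    ultimately have "4 * r ^ 3 * I 0 d r - 4 * r * I 2 d r = 8 * r * I 0 e r" by (rule DERIV_unique)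
    then have "(4 * r) * (r ^ 2 * I 0 d r - I 2 d r) = (4 * r) * (2 * I 0 e r)"
      by (simp add: algebra_simps eval_nat_numeral)
    then show ?thesis using r by simp
  qed
  have "((\<lambda>r. r ^ 2 * I 0 d r - I 2 d r) has_real_derivative 2 * r * I 0 d r) (at r)"
    by (rule DERIV_cong, (rule derivative_intros D[OF r contd])+) (simp add: algebra_simps eval_nat_numeral)
  moreover have "((\<lambda>r. 2 * I 0 e r) has_real_derivative 2 * S e r) (at r)"
    by (rule DERIV_cong, (rule derivative_intros D[OF r conte])+) simp
  then have "((\<lambda>r. r ^ 2 * I 0 d r - I 2 d r) has_real_derivative 2 * S e r) (at r)"
    by (rule has_field_derivative_transform_within_open[where S="{0<..}"]) (use r eq1 in auto)
  ultimately have "2 * r * I 0 d r = 2 * S e r" by (rule DERIV_unique)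
  moreover have "S e r = r * (r ^ n * (\<integral>x. F (r *\<^sub>R x) \<bullet> x \<partial>unit_sphere_measure))"
    by (simp add: S_def e_def)
  ultimately have "I 0 d r = r ^ n * (\<integral>x. F (r *\<^sub>R x) \<bullet> x \<partial>unit_sphere_measure)" using r by simp
  then show ?thesis by (simp add: I_def d_def n_def)
qed

section \<open>Gradient and Hessian of twice continuously differentiable functions\<close>

lemma has_derivative_grad:
  assumes "f differentiable (at x)"
  shows "(f has_derivative (\<lambda>v. grad f x \<bullet> v)) (at x)"
proof -
  have d: "(f has_derivative frechet_derivative f (at x)) (at x)"
    using assms by (simp add: frechet_derivative_works)
  interpret linear "frechet_derivative f (at x)" using d by (rule has_derivative_linear)
  have "frechet_derivative f (at x) v = grad f x \<bullet> v" for v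
  proof -
    have "frechet_derivative f (at x) v = frechet_derivative f (at x) (\<Sum>b\<in>Basis. (v \<bullet> b) *\<^sub>R b)"
      by (simp add: euclidean_representation)
    also have "\<dots> = (\<Sum>b\<in>Basis. (v \<bullet> b) * partial_deriv b f x)"
      by (simp add: sum scale partial_deriv_def)
    also have "\<dots> = grad f x \<bullet> v"
      by (simp add: grad_def inner_sum_left inner_commute[of v] mult.commute)
    finally show ?thesis .
  qed
  then show ?thesis using d by (metis ext)
qed

lemma partial_deriv_eq_inner: "f differentiable (at x) \<Longrightarrow> partial_deriv b f x = grad f x \<bullet> b"
  unfolding partial_deriv_def using frechet_derivative_at[OF has_derivative_grad] by metis

lemma has_real_derivative_along_line:
  assumes "\<And>x. f differentiable (at x)"
  shows "((\<lambda>t. f (x + t *\<^sub>R v)) has_real_derivative grad f (x + t *\<^sub>R v) \<bullet> v) (at t)"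
proof -
  have "((\<lambda>t. x + t *\<^sub>R v) has_derivative (\<lambda>t. t *\<^sub>R v)) (at t)"
    by (auto intro!: derivative_eq_intros)
  then have "((\<lambda>t. f (x + t *\<^sub>R v)) has_derivative (\<lambda>s. grad f (x + t *\<^sub>R v) \<bullet> (s *\<^sub>R v))) (at t)"
    using has_derivative_compose[of "\<lambda>t. x + t *\<^sub>R v" _ t UNIV f] has_derivative_grad[OF assms] by blast
  moreover have "(\<lambda>s. grad f (x + t *\<^sub>R v) \<bullet> (s *\<^sub>R v)) = (*) (grad f (x + t *\<^sub>R v) \<bullet> v)"
    by (auto simp: fun_eq_iff)
  ultimately show ?thesis unfolding has_field_derivative_def by simp
qed

lemma twice_cont_diffD:
  assumes "twice_cont_diff f"
  shows "f differentiable (at x)" and "b \<in> Basis \<Longrightarrow> partial_deriv b f differentiable (at x)"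
    and "b \<in> Basis \<Longrightarrow> c \<in> Basis \<Longrightarrow> continuous_on UNIV (partial_deriv c (partial_deriv b f))"
  using assms unfolding twice_cont_diff_def by blast+

text \<open>The mean value theorem in direction \<open>b\<close> for \<open>\<lambda>s. f (x + s b + h c) - f (x + s b)\<close>, then in direction
\<open>c\<close> for the partial derivative. The second difference is symmetric in \<open>b\<close> and \<open>c\<close>, which forces
the mixed partial derivatives to agree.\<close>

lemma second_difference_mean_value:
  assumes f: "twice_cont_diff f" and b: "b \<in> Basis" and c: "c \<in> Basis" and h: "h > 0"
  obtains s t where "0 < s" "s < h" "0 < t" "t < h"
    "f (x + h *\<^sub>R b + h *\<^sub>R c) - f (x + h *\<^sub>R b) - f (x + h *\<^sub>R c) + f x
      = h\<^sup>2 * partial_deriv c (partial_deriv b f) (x + s *\<^sub>R b + t *\<^sub>R c)"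
proof -
  define \<phi> where "\<phi> s = f ((x + h *\<^sub>R c) + s *\<^sub>R b) - f (x + s *\<^sub>R b)" for s
  have d\<phi>: "(\<phi> has_real_derivative
      partial_deriv b f ((x + h *\<^sub>R c) + s *\<^sub>R b) - partial_deriv b f (x + s *\<^sub>R b)) (at s)" for s
    unfolding \<phi>_def partial_deriv_eq_inner[OF twice_cont_diffD(1)[OF f]]
    by (intro DERIV_diff has_real_derivative_along_line twice_cont_diffD(1)[OF f])
  obtain s where s: "0 < s" "s < h" and 1: "\<phi> h - \<phi> 0
      = (h - 0) * (partial_deriv b f ((x + h *\<^sub>R c) + s *\<^sub>R b) - partial_deriv b f (x + s *\<^sub>R b))"
    using MVT2[OF h d\<phi>] by blast
  have dpd: "((\<lambda>t. partial_deriv b f ((x + s *\<^sub>R b) + t *\<^sub>R c)) has_real_derivative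
      partial_deriv c (partial_deriv b f) ((x + s *\<^sub>R b) + t *\<^sub>R c)) (at t)" for t
    unfolding partial_deriv_eq_inner[OF twice_cont_diffD(2)[OF f b], of c]
    by (intro has_real_derivative_along_line twice_cont_diffD(2)[OF f b])
  obtain t where t: "0 < t" "t < h" and 2: "partial_deriv b f ((x + s *\<^sub>R b) + h *\<^sub>R c)
      - partial_deriv b f ((x + s *\<^sub>R b) + 0 *\<^sub>R c)
      = (h - 0) * partial_deriv c (partial_deriv b f) ((x + s *\<^sub>R b) + t *\<^sub>R c)"
    using MVT2[OF h dpd] by blast
  have 3: "x + h *\<^sub>R c + s *\<^sub>R b = x + s *\<^sub>R b + h *\<^sub>R c" for s by (simp add: algebra_simps)
  have "f (x + h *\<^sub>R b + h *\<^sub>R c) - f (x + h *\<^sub>R b) - f (x + h *\<^sub>R c) + f x = \<phi> h - \<phi> 0"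
    by (simp add: \<phi>_def 3)
  also have "\<dots> = h\<^sup>2 * partial_deriv c (partial_deriv b f) (x + s *\<^sub>R b + t *\<^sub>R c)"
    using 1 2 by (simp add: 3 power2_eq_square)
  finally show ?thesis using s t that by blast
qed

lemma second_difference_tendsto:
  assumes f: "twice_cont_diff f" and b: "b \<in> Basis" and c: "c \<in> Basis"
  shows "((\<lambda>h. (f (x + h *\<^sub>R b + h *\<^sub>R c) - f (x + h *\<^sub>R b) - f (x + h *\<^sub>R c) + f x) / h\<^sup>2)
    \<longlongrightarrow> partial_deriv c (partial_deriv b f) x) (at_right 0)"
proof (rule tendstoI)
  let ?G = "partial_deriv c (partial_deriv b f)"
  fix e :: real assume "e > 0"
  then obtain d where d: "d > 0" "\<And>y. dist y x < d \<Longrightarrow> dist (?G y) (?G x) < e"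
    using twice_cont_diffD(3)[OF f b c] unfolding continuous_on_iff by (metis UNIV_I)
  have "dist ((f (x + h *\<^sub>R b + h *\<^sub>R c) - f (x + h *\<^sub>R b) - f (x + h *\<^sub>R c) + f x) / h\<^sup>2) (?G x) < e"
    if h: "0 < h" "h < d / 2" for h
  proof -
    obtain s t where st: "0 < s" "s < h" "0 < t" "t < h" and
      eq: "f (x + h *\<^sub>R b + h *\<^sub>R c) - f (x + h *\<^sub>R b) - f (x + h *\<^sub>R c) + f x = h\<^sup>2 * ?G (x + s *\<^sub>R b + t *\<^sub>R c)"
      using second_difference_mean_value[OF f b c h(1)] by metis
    have "norm (s *\<^sub>R b + t *\<^sub>R c) \<le> norm (s *\<^sub>R b) + norm (t *\<^sub>R c)" by (rule norm_triangle_ineq)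
    also have "\<dots> < d" using st h b c by simp
    finally have "dist (x + s *\<^sub>R b + t *\<^sub>R c) x < d" by (simp add: dist_norm add.assoc)
    then show ?thesis unfolding eq using d(2) h by simp
  qed
  then show "\<forall>\<^sub>F h in at_right 0. dist ((f (x + h *\<^sub>R b + h *\<^sub>R c) - f (x + h *\<^sub>R b) - f (x + h *\<^sub>R c) + f x) / h\<^sup>2) (?G x) < e"
    using d(1) by (intro eventually_at_rightI[of 0 "d / 2"]) auto
qed

lemma partial_deriv_commute:
  assumes f: "twice_cont_diff f" and b: "b \<in> Basis" and c: "c \<in> Basis"
  shows "partial_deriv c (partial_deriv b f) x = partial_deriv b (partial_deriv c f) x"
proof -
  have "x + h *\<^sub>R c + h *\<^sub>R b = x + h *\<^sub>R b + h *\<^sub>R c" for h :: real by (simp add: algebra_simps)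
  then have "((\<lambda>h. (f (x + h *\<^sub>R b + h *\<^sub>R c) - f (x + h *\<^sub>R b) - f (x + h *\<^sub>R c) + f x) / h\<^sup>2)
    \<longlongrightarrow> partial_deriv b (partial_deriv c f) x) (at_right 0)"
    using second_difference_tendsto[OF f c b, of x] by (simp add: algebra_simps)
  then show ?thesis
    using second_difference_tendsto[OF f b c, of x] by (intro tendsto_unique[of "at_right (0::real)"]) auto
qed

text \<open>The Hessian as a linear map, namely the derivative of the gradient. It is written with gradients
of partial derivatives so that its linearity in the direction is built in.\<close>

definition hess :: "('a::euclidean_space \<Rightarrow> real) \<Rightarrow> 'a \<Rightarrow> 'a \<Rightarrow> 'a" where
  "hess f x v = (\<Sum>b\<in>Basis. (grad (partial_deriv b f) x \<bullet> v) *\<^sub>R b)"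

lemma has_derivative_grad_hess:
  assumes "twice_cont_diff f"
  shows "(grad f has_derivative hess f x) (at x)"
  unfolding grad_def[of f, abs_def] hess_def[abs_def]
  by (intro has_derivative_sum has_derivative_scaleR_left has_derivative_grad twice_cont_diffD(2)[OF assms])

lemma hess_inner_Basis:
  assumes "twice_cont_diff f" "b \<in> Basis" "c \<in> Basis"
  shows "hess f x c \<bullet> b = partial_deriv c (partial_deriv b f) x"
  using assms(2,3) by (simp add: hess_def inner_sum_left inner_Basis if_distrib[where f="\<lambda>z. _ * z"]
    partial_deriv_eq_inner[OF twice_cont_diffD(2)[OF assms(1)]] cong: if_cong)

lemma linear_hess: "twice_cont_diff f \<Longrightarrow> linear (hess f x)"
  using has_derivative_grad_hess by (rule has_derivative_linear)

lemma continuous_on_hess: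
  assumes "twice_cont_diff f" "c \<in> Basis"
  shows "continuous_on UNIV (\<lambda>x. hess f x c)"
proof -
  have "continuous_on UNIV (\<lambda>x. grad (partial_deriv b f) x \<bullet> c)" if "b \<in> Basis" for b
    using twice_cont_diffD(3)[OF assms(1) that assms(2)]
    by (simp add: partial_deriv_eq_inner[OF twice_cont_diffD(2)[OF assms(1) that], symmetric])
  then show ?thesis unfolding hess_def
    by (intro continuous_on_sum continuous_on_scaleR continuous_on_const) auto
qed

lemma hess_symmetric:
  assumes f: "twice_cont_diff f"
  shows "hess f x v \<bullet> w = hess f x w \<bullet> v"
proof -
  interpret linear "hess f x" using f by (rule linear_hess)
  have *: "hess f x v \<bullet> w = (\<Sum>c\<in>Basis. \<Sum>b\<in>Basis. (v \<bullet> c) * (w \<bullet> b) * (hess f x c \<bullet> b))" for v w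
  proof -
    have "hess f x v \<bullet> w = hess f x (\<Sum>c\<in>Basis. (v \<bullet> c) *\<^sub>R c) \<bullet> (\<Sum>b\<in>Basis. (w \<bullet> b) *\<^sub>R b)"
      by (simp add: euclidean_representation)
    also have "\<dots> = (\<Sum>c\<in>Basis. \<Sum>b\<in>Basis. (v \<bullet> c) * (w \<bullet> b) * (hess f x c \<bullet> b))"
      by (simp only: sum scale inner_sum_left) (simp add: inner_sum_right sum_distrib_left mult.left_commute mult.assoc)
    finally show ?thesis .
  qed
  show ?thesis
    unfolding *[of v w] *[of w v]
    by (subst sum.swap, intro sum.cong refl)
      (simp add: hess_inner_Basis[OF f] partial_deriv_commute[OF f])
qed

lemma trace_hess_eq_laplacian:
  assumes "twice_cont_diff f"
  shows "(\<Sum>b\<in>Basis. hess f x b \<bullet> b) = laplacian f x"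
  unfolding laplacian_def by (intro sum.cong refl hess_inner_Basis assms)

lemma twice_cont_diff_continuous:
  assumes "twice_cont_diff f"
  shows "continuous_on UNIV f" and "continuous_on UNIV (grad f)"
  using has_derivative_grad[OF twice_cont_diffD(1)[OF assms]] has_derivative_grad_hess[OF assms]
  by (meson continuous_at_imp_continuous_on has_derivative_continuous)+

section \<open>Almgren's monotonicity and its consequences for functions of the radius\<close>

lemma powr_at_top_real: "(e::real) > 0 \<Longrightarrow> filterlim (\<lambda>r::real. r powr e) at_top at_top"
  by real_asymp

text \<open>The part of the argument that concerns functions of the radius only. The dimension is \<open>m + 2\<close>;
\<open>H\<close> is the integral of \<open>\<Sum>i. u\<^sub>i\<^sup>2\<close> over the sphere rescaled to radius one, \<open>P\<close> the energy in the ball and \<open>Q\<close> its interaction part (both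
unscaled), \<open>B\<close> the flux of \<open>\<Sum>i. u\<^sub>i \<nabla>u\<^sub>i\<close> and \<open>A\<close> the integral of the squared normal derivatives, the
latter two over the unit sphere after rescaling. The exponent \<open>2 p\<close> comes from the algebraic
growth of \<open>u\<close>.\<close>

locale almgren_quantities =
  fixes H B P P' Q A :: "real \<Rightarrow> real" and m :: nat and r0 p C :: real
  assumes r0: "r0 > 0"
    and H_deriv: "\<And>r. r > 0 \<Longrightarrow> (H has_real_derivative 2 * B r) (at r)"
    and P_deriv: "\<And>r. r > 0 \<Longrightarrow> (P has_real_derivative P' r) (at r)"
    and pohozaev: "\<And>r. r > 0 \<Longrightarrow> r * P' r = m * P r + 2 * Q r + 2 * r ^ (m + 2) * A r"
    and flux: "\<And>r. r > 0 \<Longrightarrow> r ^ (m + 1) * B r = P r + Q r"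
    and cauchy_schwarz: "\<And>r. r \<ge> r0 \<Longrightarrow> (B r)\<^sup>2 \<le> A r * H r"
    and Q_nonneg: "\<And>r. r > 0 \<Longrightarrow> 0 \<le> Q r" and P_nonneg: "\<And>r. r > 0 \<Longrightarrow> 0 \<le> P r"
    and H_pos: "\<And>r. r \<ge> r0 \<Longrightarrow> H r > 0"
    and P_pos: "\<exists>r\<ge>r0. P r > 0"
    and H_growth: "\<And>r. r \<ge> 1 \<Longrightarrow> H r \<le> C * r powr (2 * p)"
begin

definition frequency :: "real \<Rightarrow> real" where
  "frequency r = P r / r ^ m / H r"

text \<open>The excess of \<open>(ln H)'\<close> over \<open>2 n / r\<close>, where \<open>n\<close> is the frequency.\<close>

definition defect :: "real \<Rightarrow> real" where
  "defect r = 2 * Q r / (r ^ (m + 1) * H r)"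

lemma defect_nonneg: "r \<ge> r0 \<Longrightarrow> defect r \<ge> 0"
  unfolding defect_def using r0 Q_nonneg[of r] H_pos[of r] by simp

lemma log_derivative_H:
  assumes r: "r \<ge> r0"
  shows "((\<lambda>r. ln (H r)) has_real_derivative 2 * frequency r / r + defect r) (at r)"
proof -
  have pos: "r > 0" "H r > 0" using r r0 H_pos by auto
  have "((\<lambda>r. ln (H r)) has_real_derivative 1 / H r * (2 * B r)) (at r)"
    by (rule DERIV_chain'[OF H_deriv DERIV_ln_divide]) (use pos in auto)
  moreover have "B r = (P r + Q r) / r ^ (m + 1)" using flux[of r] pos by (simp add: field_simps)
  then have "1 / H r * (2 * B r) = 2 * frequency r / r + defect r"
    unfolding frequency_def defect_def using pos by (simp add: field_simps)
  ultimately show ?thesis by simp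
qed

text \<open>Almgren monotonicity in quantitative form: the frequency grows at least as fast as the integral of
the defect. After insertion of the Pohozaev identity, and of the flux identity to eliminate \<open>P\<close>, the
derivative is the defect plus the Cauchy-Schwarz deficit \<open>2 r (A H - B\<^sup>2) / H\<^sup>2\<close> plus a
nonnegative multiple of \<open>Q B\<close>.\<close>

lemma frequency_derivative:
  assumes r: "r \<ge> r0"
  obtains D where "(frequency has_real_derivative D) (at r)" "D \<ge> defect r"
proof -
  have pos: "r > 0" "H r > 0" using r r0 H_pos by auto
  define q where "q = r ^ m"
  have q: "q > 0" using pos by (simp add: q_def)
  have "((\<lambda>r. r ^ m) has_real_derivative real m * q / r) (at r)"
  proof -
    have "real m * r ^ (m - Suc 0) = real m * q / r"
      using pos by (cases m) (auto simp: q_def)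
    then show ?thesis using DERIV_pow[of m r] by simp
  qed
  note dq = this
  let ?D = "((P' r * q - P r * (real m * q / r)) / (q * q) * H r - P r / q * (2 * B r)) / (H r * H r)"
  have "(frequency has_real_derivative ?D) (at r)"
    unfolding frequency_def[abs_def] q_def
    by (intro DERIV_divide P_deriv H_deriv dq[unfolded q_def]) (use pos in auto)
  moreover have "?D \<ge> defect r"
  proof -
    have P': "P' r = (m * P r + 2 * Q r + 2 * r\<^sup>2 * q * A r) / r"
      using pohozaev[of r] pos by (simp add: field_simps q_def power_add power2_eq_square)
    have fl: "r * q * B r = P r + Q r" using flux[of r] pos by (simp add: q_def mult_ac)
    have B: "B r \<ge> 0"
    proof -
      have "r * q * B r \<ge> 0" using fl P_nonneg[of r] Q_nonneg[of r] pos by simp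
      moreover have "r * q > 0" using pos q by simp
      ultimately show ?thesis by (metis mult_neg_neg mult_pos_neg not_le)
    qed
    have Pr: "P r = r * q * B r - Q r" using fl by simp
    have "?D = defect r + 2 * r * (A r * H r - (B r)\<^sup>2) / (H r * H r) + 2 * Q r * B r / (q * (H r * H r))"
      unfolding P' defect_def Pr using pos q
      by (simp add: field_simps q_def[symmetric] power2_eq_square)
    moreover have "2 * r * (A r * H r - (B r)\<^sup>2) / (H r * H r) \<ge> 0"
      using cauchy_schwarz[OF r] pos by simp
    moreover have "2 * Q r * B r / (q * (H r * H r)) \<ge> 0"
      using Q_nonneg[of r] B pos q by simp
    ultimately show ?thesis by linarith
  qed
  ultimately show ?thesis by (rule that)
qed

lemma frequency_mono:
  assumes "r0 \<le> r" "r \<le> s"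
  shows "frequency r \<le> frequency s"
proof (rule DERIV_nonneg_imp_nondecreasing[OF assms(2)])
  fix x assume "r \<le> x" "x \<le> s"
  then have "r0 \<le> x" using assms by simp
  then show "\<exists>y. (frequency has_real_derivative y) (at x) \<and> 0 \<le> y"
    using frequency_derivative[of x] defect_nonneg[of x] by (metis order_trans)
qed

text \<open>Beyond \<open>s\<close> the frequency is at least its value at \<open>s\<close>, so the logarithmic derivative of \<open>H\<close> is at least
that of the power \<open>r\<^bsup>2 n(s)\<^esup>\<close>.\<close>

lemma H_lower_bound:
  assumes s: "s \<ge> r0" and r: "r \<ge> s"
  shows "H r \<ge> H s / s powr (2 * frequency s) * r powr (2 * frequency s)"
proof -
  let ?n = "frequency s"
  have pos: "s > 0" "r > 0" using s r r0 by auto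
  have "ln (H s) - 2 * ?n * ln s \<le> ln (H r) - 2 * ?n * ln r"
  proof (rule DERIV_nonneg_imp_nondecreasing[OF r])
    fix x assume x: "s \<le> x" "x \<le> r"
    have x0: "x > 0" "x \<ge> r0" using x pos s by auto
    have "((\<lambda>x. ln (H x) - 2 * ?n * ln x) has_real_derivative
        (2 * frequency x / x + defect x) - 2 * ?n * (1 / x)) (at x)"
      by (intro DERIV_diff log_derivative_H x0 DERIV_cmult DERIV_ln_divide)
    moreover have "2 * ?n * (1 / x) \<le> 2 * frequency x / x"
      using frequency_mono[OF s x(1)] x0 by (simp add: divide_right_mono)
    then have "0 \<le> (2 * frequency x / x + defect x) - 2 * ?n * (1 / x)"
      using defect_nonneg[OF x0(2)] by linarith
    ultimately show "\<exists>y. ((\<lambda>x. ln (H x) - 2 * ?n * ln x) has_real_derivative y) (at x) \<and> 0 \<le> y" by blast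
  qed
  then have "exp (ln (H s) - 2 * ?n * ln s + 2 * ?n * ln r) \<le> exp (ln (H r))" by simp
  then show ?thesis using pos H_pos[of s] H_pos[of r] s r
    by (simp add: exp_add exp_diff powr_def)
qed

text \<open>A frequency above \<open>p\<close> at a single radius would make \<open>H\<close> grow faster than its polynomial bound.\<close>

lemma frequency_le_growth:
  assumes s: "s \<ge> r0"
  shows "frequency s \<le> p"
proof (rule ccontr)
  assume "\<not> frequency s \<le> p"
  then have e: "2 * frequency s - 2 * p > 0" by simp
  define K where "K = H s / s powr (2 * frequency s)"
  have K: "K > 0" using H_pos[OF s] s r0 by (simp add: K_def)
  have "filterlim (\<lambda>r::real. r powr (2 * frequency s - 2 * p)) at_top at_top"
    using e by (rule powr_at_top_real)
  then have "\<forall>\<^sub>F r in at_top. C / K < r powr (2 * frequency s - 2 * p)"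
    by (auto simp: filterlim_at_top_dense)
  moreover have "\<forall>\<^sub>F r in at_top. r \<ge> max s 1" by (rule eventually_ge_at_top)
  ultimately have "\<forall>\<^sub>F r::real in at_top. False"
  proof eventually_elim
    case (elim r)
    then have r: "r \<ge> s" "r \<ge> 1" by auto
    have "K * r powr (2 * frequency s) \<le> C * r powr (2 * p)"
      using H_lower_bound[OF s r(1)] H_growth[OF r(2)] by (simp add: K_def)
    then have "r powr (2 * frequency s - 2 * p) \<le> C / K"
      using r K by (simp add: powr_diff field_simps)
    then show False using elim by simp
  qed
  then show False by simp
qed

definition limit_frequency :: real where
  "limit_frequency = (SUP r\<in>{r0..}. frequency r)"

lemma frequency_le_limit: "s \<ge> r0 \<Longrightarrow> frequency s \<le> limit_frequency"
  unfolding limit_frequency_def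
  by (rule cSUP_upper) (auto intro!: bdd_aboveI2[where M=p] frequency_le_growth)

lemma ex_frequency_gt: "d < limit_frequency \<Longrightarrow> \<exists>s\<ge>r0. frequency s > d"
  unfolding limit_frequency_def
  by (subst (asm) less_cSUP_iff) (auto intro!: bdd_aboveI2[where M=p] frequency_le_growth)

lemma frequency_tendsto: "(frequency \<longlongrightarrow> limit_frequency) at_top"
proof (rule order_tendstoI)
  fix a assume "a < limit_frequency"
  then obtain s where s: "s \<ge> r0" "frequency s > a" using ex_frequency_gt by blast
  show "\<forall>\<^sub>F r in at_top. a < frequency r"
    using eventually_ge_at_top[of s]
    by eventually_elim (use s frequency_mono in \<open>meson less_le_trans\<close>)
next
  fix a assume a: "limit_frequency < a"
  show "\<forall>\<^sub>F r in at_top. frequency r < a"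
    using eventually_ge_at_top[of r0]
    by eventually_elim (use frequency_le_limit a in \<open>meson le_less_trans\<close>)
qed

lemma limit_frequency_pos: "limit_frequency > 0"
proof -
  obtain r where r: "r \<ge> r0" "P r > 0" using P_pos by blast
  then have "frequency r > 0" unfolding frequency_def using r0 H_pos[of r] by simp
  then show ?thesis using frequency_le_limit[OF r(1)] by simp
qed

text \<open>The derivative of \<open>ln H - n\<close> is at most \<open>2 n / r \<le> 2 d / r\<close>, because the defect is absorbed by
\<open>n'\<close>; and \<open>n\<close> itself stays below its limit \<open>d\<close>. This yields the exact power \<open>2 d\<close>.\<close>

lemma H_upper_bound:
  obtains K where "\<And>r. r \<ge> r0 \<Longrightarrow> H r \<le> K * r powr (2 * limit_frequency)"
proof -
  let ?d = limit_frequency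
  \<comment> \<open>the last summand makes up for the subtracted frequency, which never exceeds the limit\<close>
  define c where "c = ln (H r0) - frequency r0 - 2 * ?d * ln r0 + ?d"
  have "H r \<le> exp c * r powr (2 * ?d)" if r: "r \<ge> r0" for r
  proof -
    have pos: "r > 0" "H r > 0" using r r0 H_pos by auto
    have "ln (H r) - frequency r - 2 * ?d * ln r \<le> ln (H r0) - frequency r0 - 2 * ?d * ln r0"
    proof (rule DERIV_nonpos_imp_nonincreasing[OF r])
      fix x assume x: "r0 \<le> x" "x \<le> r"
      then have x0: "x > 0" using r0 by simp
      obtain D where D: "(frequency has_real_derivative D) (at x)" "D \<ge> defect x"
        using frequency_derivative[OF x(1)] by blast
      have "((\<lambda>x. ln (H x) - frequency x - 2 * ?d * ln x) has_real_derivative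
          (2 * frequency x / x + defect x) - D - 2 * ?d * (1 / x)) (at x)"
        by (intro DERIV_diff log_derivative_H x x0 D DERIV_cmult DERIV_ln_divide)
      moreover have "2 * frequency x / x \<le> 2 * ?d * (1 / x)"
        using frequency_le_limit[OF x(1)] x0 by (simp add: divide_right_mono)
      then have "(2 * frequency x / x + defect x) - D - 2 * ?d * (1 / x) \<le> 0"
        using D(2) by linarith
      ultimately show "\<exists>y. ((\<lambda>x. ln (H x) - frequency x - 2 * ?d * ln x) has_real_derivative y) (at x) \<and> y \<le> 0"
        by blast
    qed
    then have "ln (H r) \<le> c + 2 * ?d * ln r"
      using frequency_le_limit[OF r] by (simp add: c_def)
    then have "exp (ln (H r)) \<le> exp (c + 2 * ?d * ln r)" by simp
    then show ?thesis using pos by (simp add: exp_add powr_def)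
  qed
  then show ?thesis by (rule that)
qed

lemma H_dominates_lower_powers:
  assumes "d < limit_frequency"
  shows "filterlim (\<lambda>r. H r / r powr (2 * d)) at_top at_top"
proof -
  obtain s where s: "s \<ge> r0" "frequency s > d" using ex_frequency_gt assms by blast
  define K where "K = H s / s powr (2 * frequency s)"
  have K: "K > 0" using H_pos[OF s(1)] s r0 by (simp add: K_def)
  have e: "2 * frequency s - 2 * d > 0" using s by simp
  have "filterlim (\<lambda>r::real. K * r powr (2 * frequency s - 2 * d)) at_top at_top"
    by (rule filterlim_tendsto_pos_mult_at_top[OF tendsto_const K powr_at_top_real[OF e]])
  moreover have "\<forall>\<^sub>F r in at_top. K * r powr (2 * frequency s - 2 * d) \<le> H r / r powr (2 * d)"
    using eventually_ge_at_top[of s]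
  proof eventually_elim
    case (elim r)
    have "K * r powr (2 * frequency s) / r powr (2 * d) \<le> H r / r powr (2 * d)"
      using H_lower_bound[OF s(1) elim] by (intro divide_right_mono) (simp_all add: K_def)
    then show ?case by (simp add: powr_diff)
  qed
  ultimately show ?thesis by (rule filterlim_at_top_mono)
qed

lemma H_dominated_by_higher_powers:
  assumes "d > limit_frequency"
  shows "((\<lambda>r. H r / r powr (2 * d)) \<longlongrightarrow> 0) at_top"
proof -
  obtain K where K: "\<And>r. r \<ge> r0 \<Longrightarrow> H r \<le> K * r powr (2 * limit_frequency)"
    using H_upper_bound by blast
  have e: "2 * limit_frequency - 2 * d < 0" using assms by simp
  show ?thesis
  proof (rule Lim_null_comparison)
    show "\<forall>\<^sub>F r in at_top. norm (H r / r powr (2 * d)) \<le> K * r powr (2 * limit_frequency - 2 * d)"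
      using eventually_ge_at_top[of r0]
    proof eventually_elim
      case (elim r)
      then show ?case using K[OF elim] H_pos[OF elim] r0
        by (simp add: powr_diff divide_right_mono)
    qed
    show "((\<lambda>r. K * r powr (2 * limit_frequency - 2 * d)) \<longlongrightarrow> 0) at_top"
      using e by (intro tendsto_mult_right_zero tendsto_neg_powr filterlim_ident)
  qed
qed

end

section \<open>Integral identities for solutions of the system\<close>

text \<open>Passes between the sum over unordered pairs in the energy and the sums over \<open>j \<noteq> i\<close> in the
equations.\<close>

lemma sum_pairs_symmetrize:
  fixes a :: "nat \<Rightarrow> nat \<Rightarrow> 'b::comm_monoid_add"
  shows "(\<Sum>i=1..k. \<Sum>j=i+1..k. a i j + a j i) = (\<Sum>i=1..k. \<Sum>j\<in>{1..k}-{i}. a i j)"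
proof (induction k)
  case (Suc k)
  have 1: "(\<Sum>j=i+1..Suc k. a i j + a j i) = (\<Sum>j=i+1..k. a i j + a j i) + (a i (Suc k) + a (Suc k) i)"
    if "i \<in> {1..k}" for i using that by simp
  have "(\<Sum>j\<in>{1..Suc k}-{i}. a i j) = (\<Sum>j\<in>{1..k}-{i}. a i j) + a i (Suc k)" if "i \<in> {1..k}" for i
  proof -
    have "{1..Suc k}-{i} = insert (Suc k) ({1..k}-{i})" using that by auto
    then show ?thesis by (simp add: add.commute)
  qed
  note 2 = this
  have 3: "{1..Suc k} - {Suc k} = {1..k}" by auto
  have "(\<Sum>i=1..Suc k. \<Sum>j=i+1..Suc k. a i j + a j i)
     = (\<Sum>i=1..k. \<Sum>j=i+1..k. a i j + a j i) + (\<Sum>i=1..k. a i (Suc k)) + (\<Sum>i=1..k. a (Suc k) i)"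
  proof -
    have "(\<Sum>i=1..Suc k. \<Sum>j=i+1..Suc k. a i j + a j i) = (\<Sum>i=1..k. \<Sum>j=i+1..Suc k. a i j + a j i)"
      by simp
    also have "\<dots> = (\<Sum>i=1..k. (\<Sum>j=i+1..k. a i j + a j i) + (a i (Suc k) + a (Suc k) i))"
      by (rule sum.cong[OF refl 1])
    finally show ?thesis by (simp only: sum.distrib add.assoc)
  qed
  also have "\<dots> = (\<Sum>i=1..Suc k. \<Sum>j\<in>{1..Suc k}-{i}. a i j)"
    unfolding Suc.IH using sum.cong[OF refl 2, of "{1..k}"] by (simp add: sum.distrib 3[unfolded One_nat_def])
  finally show ?case .
qed simp

locale segregation_system =
  fixes k :: nat and u :: "nat \<Rightarrow> 'a::euclidean_space \<Rightarrow> real"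
  assumes dim: "DIM('a) \<ge> 2" and solves: "solves_system k u"
begin

lemma C2: "i \<in> {1..k} \<Longrightarrow> twice_cont_diff (u i)"
  and laplacian_eq: "i \<in> {1..k} \<Longrightarrow> laplacian (u i) x = (\<Sum>j\<in>{1..k}-{i}. (u j x)\<^sup>2 * u i x)"
  using solves by (auto simp: solves_system_def)

definition dirichlet :: "'a \<Rightarrow> real" where
  "dirichlet x = (\<Sum>i=1..k. (norm (grad (u i) x))\<^sup>2)"

definition interaction :: "'a \<Rightarrow> real" where
  "interaction x = (\<Sum>i=1..k. \<Sum>j=i+1..k. (u i x)\<^sup>2 * (u j x)\<^sup>2)"

definition sphere_mass :: "real \<Rightarrow> real" where
  "sphere_mass r = (\<integral>x. (\<Sum>i=1..k. (u i (r *\<^sub>R x))\<^sup>2) \<partial>unit_sphere_measure)"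

definition sphere_flux :: "real \<Rightarrow> real" where
  "sphere_flux r = (\<integral>x. (\<Sum>i=1..k. u i (r *\<^sub>R x) * (grad (u i) (r *\<^sub>R x) \<bullet> x)) \<partial>unit_sphere_measure)"

definition sphere_normal_energy :: "real \<Rightarrow> real" where
  "sphere_normal_energy r = (\<integral>x. (\<Sum>i=1..k. (grad (u i) (r *\<^sub>R x) \<bullet> x)\<^sup>2) \<partial>unit_sphere_measure)"

definition ball_energy :: "real \<Rightarrow> real" where
  "ball_energy r = (LINT x:ball 0 r|lborel. dirichlet x + interaction x)"

definition ball_interaction :: "real \<Rightarrow> real" where
  "ball_interaction r = (LINT x:ball 0 r|lborel. interaction x)"

lemma u_has_derivative: "i \<in> {1..k} \<Longrightarrow> (u i has_derivative (\<lambda>v. grad (u i) x \<bullet> v)) (at x)"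
  by (intro has_derivative_grad twice_cont_diffD(1) C2)

lemma continuous_u: "i \<in> {1..k} \<Longrightarrow> continuous_on UNIV (u i)"
  and continuous_grad: "i \<in> {1..k} \<Longrightarrow> continuous_on UNIV (grad (u i))"
  using twice_cont_diff_continuous[OF C2] by blast+

lemma continuous_dirichlet: "continuous_on UNIV dirichlet"
  unfolding dirichlet_def[abs_def] by (intro continuous_intros continuous_grad)

lemma continuous_interaction: "continuous_on UNIV interaction"
  unfolding interaction_def[abs_def] by (intro continuous_intros continuous_u) auto

lemma dirichlet_nonneg: "dirichlet x \<ge> 0"
  unfolding dirichlet_def by (intro sum_nonneg) auto

lemma interaction_nonneg: "interaction x \<ge> 0"
  unfolding interaction_def by (intro sum_nonneg) auto

lemma sum_u_laplacian: "(\<Sum>i=1..k. u i x * laplacian (u i) x) = 2 * interaction x"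
proof -
  have "2 * interaction x = (\<Sum>i=1..k. \<Sum>j=i+1..k. (u i x)\<^sup>2 * (u j x)\<^sup>2 + (u j x)\<^sup>2 * (u i x)\<^sup>2)"
    by (simp add: interaction_def sum_distrib_left mult.commute)
  also have "\<dots> = (\<Sum>i=1..k. \<Sum>j\<in>{1..k}-{i}. (u i x)\<^sup>2 * (u j x)\<^sup>2)"
    by (rule sum_pairs_symmetrize)
  also have "\<dots> = (\<Sum>i=1..k. u i x * laplacian (u i) x)"
    by (intro sum.cong refl) (simp add: laplacian_eq sum_distrib_left power2_eq_square mult_ac)
  finally show ?thesis by simp
qed

text \<open>The variational structure of the system: the partial derivative of the interaction density with
respect to \<open>u\<^sub>i\<close> is \<open>2 u\<^sub>i (\<Sum>j\<noteq>i. u\<^sub>j\<^sup>2)\<close>, which is \<open>2 \<Delta>u\<^sub>i\<close>.\<close>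

lemma interaction_has_derivative:
  "(interaction has_derivative (\<lambda>v. \<Sum>i=1..k. 2 * laplacian (u i) x * (grad (u i) x \<bullet> v))) (at x)"
proof -
  have "(interaction has_derivative (\<lambda>v. \<Sum>i=1..k. \<Sum>j=i+1..k.
      2 * u i x * (grad (u i) x \<bullet> v) * (u j x)\<^sup>2 + 2 * u j x * (grad (u j) x \<bullet> v) * (u i x)\<^sup>2)) (at x)"
    unfolding interaction_def[abs_def]
  proof (intro has_derivative_sum)
    fix i j assume "i \<in> {1..k}" "j \<in> {i+1..k}"
    then have i: "i \<in> {1..k}" and j: "j \<in> {1..k}" by auto
    show "((\<lambda>x. (u i x)\<^sup>2 * (u j x)\<^sup>2) has_derivative (\<lambda>v. 2 * u i x * (grad (u i) x \<bullet> v) * (u j x)\<^sup>2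
        + 2 * u j x * (grad (u j) x \<bullet> v) * (u i x)\<^sup>2)) (at x)"
      by (rule derivative_eq_intros u_has_derivative[OF i] u_has_derivative[OF j] refl)+
        (simp add: fun_eq_iff algebra_simps)
  qed
  also have "(\<lambda>v. \<Sum>i=1..k. \<Sum>j=i+1..k.
      2 * u i x * (grad (u i) x \<bullet> v) * (u j x)\<^sup>2 + 2 * u j x * (grad (u j) x \<bullet> v) * (u i x)\<^sup>2)
    = (\<lambda>v. \<Sum>i=1..k. 2 * laplacian (u i) x * (grad (u i) x \<bullet> v))"
    unfolding sum_pairs_symmetrize[of "\<lambda>i j. 2 * u i x * (grad (u i) x \<bullet> v) * (u j x)\<^sup>2" for v]
    by (intro ext sum.cong refl)
      (simp add: laplacian_eq sum_distrib_left sum_distrib_right mult_ac)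
  finally show ?thesis .
qed

lemma dirichlet_has_derivative:
  "(dirichlet has_derivative (\<lambda>v. \<Sum>i=1..k. 2 * (grad (u i) x \<bullet> hess (u i) x v))) (at x)"
  unfolding dirichlet_def[abs_def] power2_norm_eq_inner
  by (intro has_derivative_sum)
    (auto intro!: derivative_eq_intros has_derivative_grad_hess C2 simp: inner_commute)

lemma sphere_mass_derivative: "(sphere_mass has_real_derivative 2 * sphere_flux r) (at r)"
proof -
  have d: "((\<lambda>x. \<Sum>i=1..k. (u i x)\<^sup>2) has_derivative (\<lambda>v. (\<Sum>i=1..k. (2 * u i x) *\<^sub>R grad (u i) x) \<bullet> v)) (at x)" for x
    unfolding inner_sum_left
    by (intro has_derivative_sum) (auto intro!: derivative_eq_intros u_has_derivative)
  have "(sphere_mass has_real_derivative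
     (\<integral>x. (\<Sum>i=1..k. (2 * u i (r *\<^sub>R x)) *\<^sub>R grad (u i) (r *\<^sub>R x)) \<bullet> x \<partial>unit_sphere_measure)) (at r)"
    unfolding sphere_mass_def[abs_def]
    by (rule has_real_derivative_unit_sphere_integral[OF d])
      (intro continuous_intros continuous_u continuous_grad)
  then show ?thesis
    by (simp add: sphere_flux_def inner_sum_left sum_distrib_left[symmetric] mult.assoc)
qed

text \<open>The divergence theorem for \<open>\<Sum>i. u\<^sub>i \<nabla>u\<^sub>i\<close>. The equations contribute each unordered pair twice, so the
interaction appears once more than in the energy.\<close>

lemma flux_identity:
  assumes r: "r > 0"
  shows "r ^ (DIM('a) - 1) * sphere_flux r = ball_energy r + ball_interaction r"
proof -
  define F where "F x = (\<Sum>i=1..k. u i x *\<^sub>R grad (u i) x)" for x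
  define F' where "F' x v = (\<Sum>i=1..k. u i x *\<^sub>R hess (u i) x v + (grad (u i) x \<bullet> v) *\<^sub>R grad (u i) x)" for x v
  have d: "(F has_derivative F' x) (at x)" for x
    unfolding F_def[abs_def] F'_def[abs_def]
    by (intro has_derivative_sum has_derivative_scaleR u_has_derivative has_derivative_grad_hess C2)
  have c: "continuous_on UNIV (\<lambda>x. F' x b)" if "b \<in> Basis" for b
    unfolding F'_def by (intro continuous_intros continuous_u continuous_grad continuous_on_hess C2 that)
  have div: "(\<Sum>b\<in>Basis. F' x b \<bullet> b) = (dirichlet x + interaction x) + interaction x" for x
  proof -
    have "(\<Sum>b\<in>Basis. F' x b \<bullet> b)
      = (\<Sum>i=1..k. u i x * (\<Sum>b\<in>Basis. hess (u i) x b \<bullet> b) + (\<Sum>b\<in>Basis. (grad (u i) x \<bullet> b) * (grad (u i) x \<bullet> b)))"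
      unfolding F'_def inner_sum_left
      by (subst sum.swap) (simp add: inner_add_left sum.distrib sum_distrib_left)
    also have "\<dots> = (\<Sum>i=1..k. u i x * laplacian (u i) x + (norm (grad (u i) x))\<^sup>2)"
      by (intro sum.cong refl)
        (simp add: trace_hess_eq_laplacian C2 euclidean_inner[symmetric] power2_norm_eq_inner)
    also have "\<dots> = (dirichlet x + interaction x) + interaction x"
      unfolding sum.distrib sum_u_laplacian dirichlet_def by simp
    finally show ?thesis .
  qed
  have gauss: "(LINT x:ball 0 r|lborel. (\<Sum>b\<in>Basis. F' x b \<bullet> b))
      = r ^ (DIM('a) - 1) * (\<integral>x. F (r *\<^sub>R x) \<bullet> x \<partial>unit_sphere_measure)"
    by (rule divergence_theorem_ball[OF d c r])
  have "r ^ (DIM('a) - 1) * sphere_flux r = (LINT x:ball 0 r|lborel. (\<Sum>b\<in>Basis. F' x b \<bullet> b))"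
    unfolding gauss sphere_flux_def F_def by (simp add: inner_sum_left)
  also have "\<dots> = ball_energy r + ball_interaction r"
    unfolding div ball_energy_def ball_interaction_def
    by (intro set_integral_add set_integrable_ball continuous_intros continuous_dirichlet continuous_interaction)
  finally show ?thesis .
qed

text \<open>The divergence theorem for the field \<open>e x - 2 (\<Sum>i. (x \<bullet> \<nabla>u\<^sub>i) \<nabla>u\<^sub>i)\<close>, with \<open>e\<close> the energy density. In its
divergence all second derivatives cancel: those of the Dirichlet part by symmetry of the Hessian,
and \<open>2 (x \<bullet> \<nabla>u\<^sub>i) \<Delta>u\<^sub>i\<close> against the radial derivative of the interaction density. What is left is
\<open>N e - 2 (\<Sum>i. |\<nabla>u\<^sub>i|\<^sup>2)\<close>.\<close>

lemma pohozaev_identity: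
  assumes r: "r > 0"
  defines "S \<equiv> \<integral>x. dirichlet (r *\<^sub>R x) + interaction (r *\<^sub>R x) \<partial>unit_sphere_measure"
  shows "r ^ DIM('a) * S = real (DIM('a) - 2) * ball_energy r + 2 * ball_interaction r
    + 2 * r ^ DIM('a) * sphere_normal_energy r"
proof -
  define e where "e x = dirichlet x + interaction x" for x
  define e' where "e' x v = (\<Sum>i=1..k. 2 * (grad (u i) x \<bullet> hess (u i) x v))
    + (\<Sum>i=1..k. 2 * laplacian (u i) x * (grad (u i) x \<bullet> v))" for x v
  have de: "(e has_derivative e' x) (at x)" for x
    unfolding e_def[abs_def] e'_def[abs_def]
    by (intro has_derivative_add dirichlet_has_derivative interaction_has_derivative)
  define F where "F x = e x *\<^sub>R x - (\<Sum>i=1..k. (2 * (grad (u i) x \<bullet> x)) *\<^sub>R grad (u i) x)" for x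
  define F' where "F' x v = (e x *\<^sub>R v + e' x v *\<^sub>R x)
     - (\<Sum>i=1..k. (2 * (grad (u i) x \<bullet> x)) *\<^sub>R hess (u i) x v
         + (2 * (grad (u i) x \<bullet> v + hess (u i) x v \<bullet> x)) *\<^sub>R grad (u i) x)" for x v
  have d: "(F has_derivative F' x) (at x)" for x
    unfolding F_def[abs_def] F'_def[abs_def]
    by (intro has_derivative_diff has_derivative_sum has_derivative_scaleR de has_derivative_ident
        has_derivative_mult_right has_derivative_inner has_derivative_grad_hess C2)
  have conte: "continuous_on UNIV e"
    unfolding e_def[abs_def] by (intro continuous_intros continuous_dirichlet continuous_interaction)
  have contl: "continuous_on UNIV (laplacian (u i))" if "i \<in> {1..k}" for i
    unfolding laplacian_eq[OF that, abs_def] by (intro continuous_intros continuous_u that) auto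
  have c: "continuous_on UNIV (\<lambda>x. F' x b)" if "b \<in> Basis" for b
    unfolding F'_def e'_def
    by (intro continuous_intros conte contl continuous_u continuous_grad continuous_on_hess C2 that)
  have div: "(\<Sum>b\<in>Basis. F' x b \<bullet> b) = real (DIM('a) - 2) * e x + 2 * interaction x" for x
  proof -
    interpret e': linear "e' x" using de by (rule has_derivative_linear)
    \<comment> \<open>divergence of \<open>e x\<close>\<close>
    have t1: "(\<Sum>b\<in>Basis. (e x *\<^sub>R b + e' x b *\<^sub>R x) \<bullet> b) = real DIM('a) * e x + e' x x"
    proof -
      have "e' x x = e' x (\<Sum>b\<in>Basis. (x \<bullet> b) *\<^sub>R b)" by (simp add: euclidean_representation)
      also have "\<dots> = (\<Sum>b\<in>Basis. e' x b * (x \<bullet> b))" by (simp add: e'.sum e'.scale mult.commute)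
      finally show ?thesis by (simp add: inner_add_left sum.distrib)
    qed
    \<comment> \<open>divergence of \<open>2 (x \<bullet> \<nabla>u\<^sub>i) \<nabla>u\<^sub>i\<close>\<close>
    have t2: "(\<Sum>b\<in>Basis. ((2 * (grad (u i) x \<bullet> x)) *\<^sub>R hess (u i) x b
         + (2 * (grad (u i) x \<bullet> b + hess (u i) x b \<bullet> x)) *\<^sub>R grad (u i) x) \<bullet> b)
       = 2 * laplacian (u i) x * (grad (u i) x \<bullet> x) + 2 * (norm (grad (u i) x))\<^sup>2 + 2 * (grad (u i) x \<bullet> hess (u i) x x)"
      (is "?L = _") if i: "i \<in> {1..k}" for i
    proof -
      let ?g = "grad (u i) x"
      have "?L = 2 * (?g \<bullet> x) * (\<Sum>b\<in>Basis. hess (u i) x b \<bullet> b) + 2 * (\<Sum>b\<in>Basis. (?g \<bullet> b) * (?g \<bullet> b))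
          + 2 * (\<Sum>b\<in>Basis. (hess (u i) x x \<bullet> b) * (?g \<bullet> b))"
        by (simp add: hess_symmetric[OF C2[OF i], of x _ x] inner_add_left sum.distrib sum_distrib_left algebra_simps)
      then show ?thesis
        unfolding trace_hess_eq_laplacian[OF C2[OF i]] euclidean_inner[symmetric]
        by (simp add: power2_norm_eq_inner inner_commute)
    qed
    have "(\<Sum>b\<in>Basis. F' x b \<bullet> b) = real DIM('a) * e x + e' x x
      - (\<Sum>i=1..k. 2 * laplacian (u i) x * (grad (u i) x \<bullet> x) + 2 * (norm (grad (u i) x))\<^sup>2 + 2 * (grad (u i) x \<bullet> hess (u i) x x))"
      unfolding F'_def inner_diff_left sum_subtractf t1 inner_sum_left
      by (subst sum.swap) (use t2 in simp)
    also have "\<dots> = real DIM('a) * e x - 2 * dirichlet x"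
      by (simp add: e'_def dirichlet_def sum.distrib sum_distrib_left)
    also have "\<dots> = real (DIM('a) - 2) * e x + 2 * interaction x"
      using dim by (simp add: e_def of_nat_diff algebra_simps)
    finally show ?thesis .
  qed
  have pow: "r ^ DIM('a) = r ^ (DIM('a) - 1) * r"
    by (metis DIM_positive Suc_diff_1 power_Suc2)
  have normal: "(\<integral>x. F (r *\<^sub>R x) \<bullet> x \<partial>unit_sphere_measure) = r * S - 2 * r * sphere_normal_energy r"
  proof -
    have sc: "continuous_on UNIV (\<lambda>x. g (r *\<^sub>R x))" if "continuous_on UNIV g" for g :: "'a \<Rightarrow> 'b::topological_space"
      by (rule continuous_on_compose2[OF that]) (auto intro: continuous_intros)
    have "(\<integral>x. F (r *\<^sub>R x) \<bullet> x \<partial>unit_sphere_measure)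
      = (\<integral>x. r * e (r *\<^sub>R x) - 2 * r * (\<Sum>i=1..k. (grad (u i) (r *\<^sub>R x) \<bullet> x)\<^sup>2) \<partial>unit_sphere_measure)"
    proof (rule integral_cong_AE)
      show "(\<lambda>x. F (r *\<^sub>R x) \<bullet> x) \<in> borel_measurable unit_sphere_measure"
        unfolding F_def
        by (intro borel_measurable_continuous_sphere continuous_intros sc conte continuous_grad)
      show "(\<lambda>x. r * e (r *\<^sub>R x) - 2 * r * (\<Sum>i=1..k. (grad (u i) (r *\<^sub>R x) \<bullet> x)\<^sup>2)) \<in> borel_measurable unit_sphere_measure"
        by (intro borel_measurable_continuous_sphere continuous_intros sc conte continuous_grad)
      show "AE x in unit_sphere_measure. F (r *\<^sub>R x) \<bullet> x = r * e (r *\<^sub>R x) - 2 * r * (\<Sum>i=1..k. (grad (u i) (r *\<^sub>R x) \<bullet> x)\<^sup>2)"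
        using AE_unit_sphere_norm
      proof eventually_elim
        case (elim x)
        then have "x \<bullet> x = 1" by (simp add: norm_eq_1)
        then show ?case
          by (simp add: F_def inner_diff_left inner_sum_left sum_distrib_left power2_eq_square mult_ac)
      qed
    qed
    also have "\<dots> = (\<integral>x. r * e (r *\<^sub>R x) \<partial>unit_sphere_measure)
       - (\<integral>x. 2 * r * (\<Sum>i=1..k. (grad (u i) (r *\<^sub>R x) \<bullet> x)\<^sup>2) \<partial>unit_sphere_measure)"
      by (intro Bochner_Integration.integral_diff integrable_unit_sphere continuous_intros sc conte continuous_grad)
    also have "\<dots> = r * S - 2 * r * sphere_normal_energy r"
      by (simp add: S_def e_def sphere_normal_energy_def)
    finally show ?thesis .
  qed
  have gauss: "(LINT x:ball 0 r|lborel. (\<Sum>b\<in>Basis. F' x b \<bullet> b))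
      = r ^ (DIM('a) - 1) * (\<integral>x. F (r *\<^sub>R x) \<bullet> x \<partial>unit_sphere_measure)"
    by (rule divergence_theorem_ball[OF d c r])
  have "r ^ DIM('a) * S - 2 * r ^ DIM('a) * sphere_normal_energy r
     = (LINT x:ball 0 r|lborel. (\<Sum>b\<in>Basis. F' x b \<bullet> b))"
    unfolding gauss normal pow by (simp add: algebra_simps)
  also have "\<dots> = (LINT x:ball 0 r|lborel. real (DIM('a) - 2) * e x) + (LINT x:ball 0 r|lborel. 2 * interaction x)"
    unfolding div by (intro set_integral_add set_integrable_ball continuous_intros conte continuous_interaction)
  also have "\<dots> = real (DIM('a) - 2) * ball_energy r + 2 * ball_interaction r"
    by (simp add: ball_energy_def ball_interaction_def e_def[abs_def])
  finally show ?thesis by simp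
qed

text \<open>Expansion of the nonnegative integral of \<open>\<Sum>i. (\<partial>\<^sub>\<nu>u\<^sub>i - c u\<^sub>i)\<^sup>2\<close> at its minimising value
\<open>c = B / H\<close>.\<close>

lemma sphere_cauchy_schwarz:
  assumes pos: "sphere_mass r > 0"
  shows "(sphere_flux r)\<^sup>2 \<le> sphere_normal_energy r * sphere_mass r"
proof -
  let ?H = "sphere_mass r" and ?B = "sphere_flux r" and ?A = "sphere_normal_energy r"
  define c where "c = ?B / ?H"
  have sc: "continuous_on UNIV (\<lambda>x. g (r *\<^sub>R x))" if "continuous_on UNIV g" for g :: "'a \<Rightarrow> 'b::topological_space"
    by (rule continuous_on_compose2[OF that]) (auto intro: continuous_intros)
  define a where "a x = (\<Sum>i=1..k. (grad (u i) (r *\<^sub>R x) \<bullet> x)\<^sup>2)" for x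
  define b where "b x = (\<Sum>i=1..k. u i (r *\<^sub>R x) * (grad (u i) (r *\<^sub>R x) \<bullet> x))" for x
  define h where "h x = (\<Sum>i=1..k. (u i (r *\<^sub>R x))\<^sup>2)" for x
  have int: "integrable unit_sphere_measure a" "integrable unit_sphere_measure b" "integrable unit_sphere_measure h"
    unfolding a_def[abs_def] b_def[abs_def] h_def[abs_def]
    by (intro integrable_unit_sphere continuous_intros sc continuous_u continuous_grad; assumption)+
  have "0 \<le> (\<integral>x. (\<Sum>i=1..k. (grad (u i) (r *\<^sub>R x) \<bullet> x - c * u i (r *\<^sub>R x))\<^sup>2) \<partial>unit_sphere_measure)"
    by (intro integral_nonneg_AE AE_I2 sum_nonneg) auto
  also have "(\<lambda>x. \<Sum>i=1..k. (grad (u i) (r *\<^sub>R x) \<bullet> x - c * u i (r *\<^sub>R x))\<^sup>2) = (\<lambda>x. a x - 2 * c * b x + c\<^sup>2 * h x)"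
    unfolding a_def b_def h_def
    by (simp add: fun_eq_iff power2_diff sum.distrib sum_subtractf sum_distrib_left power_mult_distrib algebra_simps)
  also have "(\<integral>x. a x - 2 * c * b x + c\<^sup>2 * h x \<partial>unit_sphere_measure) = ?A - 2 * c * ?B + c\<^sup>2 * ?H"
    using int unfolding sphere_mass_def sphere_flux_def sphere_normal_energy_def a_def[symmetric] b_def[symmetric] h_def[symmetric]
    by simp
  also have "\<dots> = ?A - ?B\<^sup>2 / ?H" using pos by (simp add: c_def power2_eq_square field_simps)
  finally show ?thesis using pos by (simp add: field_simps)
qed

section \<open>Positivity and growth\<close>

lemma H_fun_eq_sphere_mass:
  assumes r: "r > 0"
  shows "H_fun k u 0 r = sphere_mass r"
proof -
  have "continuous_on UNIV (\<lambda>x. \<Sum>i=1..k. (u i x)\<^sup>2)"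
    by (intro continuous_intros continuous_u)
  from integral_sphere_measure_eq[OF this r] show ?thesis
    using r by (simp add: H_fun_def sphere_mass_def)
qed

lemma E_fun_eq_ball_energy: "E_fun k u 0 r = ball_energy r / r ^ (DIM('a) - 2)"
  by (simp add: E_fun_def ball_energy_def dirichlet_def interaction_def)

lemma ball_energy_derivative:
  "r > 0 \<Longrightarrow> (ball_energy has_real_derivative r ^ (DIM('a) - 1) *
     (\<integral>x. dirichlet (r *\<^sub>R x) + interaction (r *\<^sub>R x) \<partial>unit_sphere_measure)) (at r)"
  unfolding ball_energy_def[abs_def]
  by (rule has_real_derivative_ball_integral)
    (intro continuous_intros continuous_dirichlet continuous_interaction)

lemma ball_interaction_nonneg: "ball_interaction r \<ge> 0"
  unfolding ball_interaction_def set_lebesgue_integral_def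
  by (rule integral_nonneg_AE) (use interaction_nonneg in auto)

lemma ball_energy_nonneg: "ball_energy r \<ge> 0"
  unfolding ball_energy_def set_lebesgue_integral_def
  by (rule integral_nonneg_AE) (use interaction_nonneg dirichlet_nonneg in auto)

lemma sphere_mass_nonneg: "sphere_mass r \<ge> 0"
  unfolding sphere_mass_def by (intro integral_nonneg_AE AE_I2 sum_nonneg) auto

lemma sphere_flux_nonneg:
  assumes r: "r > 0"
  shows "sphere_flux r \<ge> 0"
proof -
  have "r ^ (DIM('a) - 1) * sphere_flux r \<ge> 0"
    unfolding flux_identity[OF r] using ball_energy_nonneg ball_interaction_nonneg by (intro add_nonneg_nonneg)
  moreover have "r ^ (DIM('a) - 1) > 0" using r by simp
  ultimately show ?thesis by (metis mult_pos_neg not_le)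
qed

lemma sphere_mass_mono:
  assumes "0 < r" "r \<le> s"
  shows "sphere_mass r \<le> sphere_mass s"
proof (rule DERIV_nonneg_imp_nondecreasing[OF assms(2)])
  fix x assume "r \<le> x" "x \<le> s"
  then show "\<exists>y. (sphere_mass has_real_derivative y) (at x) \<and> 0 \<le> y"
    using sphere_flux_nonneg[of x] assms
    by (intro exI[of _ "2 * sphere_flux x"] conjI sphere_mass_derivative) auto
qed

text \<open>By monotonicity one positive value is enough. If the mass vanished at all radii up to \<open>|x| + 1\<close>, then by
polar coordinates the integral of \<open>\<Sum>i. u\<^sub>i\<^sup>2\<close> over a ball containing \<open>x\<close> would be zero.\<close>

lemma sphere_mass_eventually_pos:
  assumes i: "i \<in> {1..k}" and x: "u i x \<noteq> 0"
  obtains r0 where "r0 > 0" "\<And>r. r \<ge> r0 \<Longrightarrow> sphere_mass r > 0"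
proof -
  define f where "f x = (\<Sum>i=1..k. (u i x)\<^sup>2)" for x
  have contf: "continuous_on UNIV f"
    unfolding f_def[abs_def] by (intro continuous_intros continuous_u)
  have "f x > 0"
    unfolding f_def using i x by (intro sum_pos2[of _ i]) auto
  moreover have "f y \<ge> 0" for y unfolding f_def by (intro sum_nonneg) auto
  ultimately have pos: "(LINT y:ball 0 (norm x + 1)|lborel. f y) > 0"
    by (intro ball_integral_pos[OF contf]) auto
  have "\<exists>r\<in>{0<..norm x + 1}. sphere_mass r > 0"
  proof (rule ccontr)
    assume "\<not> ?thesis"
    then have "sphere_mass r = 0" if "r \<in> {0<..norm x + 1}" for r
      using that sphere_mass_nonneg[of r] by force
    then have "r ^ (DIM('a) - 1) * (\<integral>y. f (r *\<^sub>R y) \<partial>unit_sphere_measure) = 0" if "r \<in> {0..norm x + 1}" for r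
      using that dim by (cases "r = 0") (auto simp: sphere_mass_def f_def)
    then have "(LINT y:ball 0 (norm x + 1)|lborel. f y) = integral {0..norm x + 1} (\<lambda>_. 0)"
      unfolding ball_integral_polar[OF contf, of "norm x + 1", OF add_nonneg_pos[OF norm_ge_zero zero_less_one]]
      by (intro integral_cong)
    then show False using pos by simp
  qed
  then obtain r0 where "r0 > 0" "sphere_mass r0 > 0" by auto
  then show ?thesis using sphere_mass_mono that by (meson less_le_trans)
qed

text \<open>If the energy density vanished identically, every component would be constant and the products of
distinct components would be zero, contradicting the two nontrivial ones.\<close>

lemma ball_energy_pos:
  assumes i: "i \<in> {1..k}" "u i x \<noteq> 0" and j: "j \<in> {1..k}" "u j y \<noteq> 0" and ij: "i \<noteq> j"
  shows "\<exists>r\<ge>r0. ball_energy r > 0"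
proof -
  have "\<exists>z. dirichlet z + interaction z > 0"
  proof (rule ccontr)
    assume "\<not> ?thesis"
    then have 0: "dirichlet z = 0" "interaction z = 0" for z
      using dirichlet_nonneg[of z] interaction_nonneg[of z] by (force dest: spec[of _ z])+
    have const: "u l z = u l w" if l: "l \<in> {1..k}" for l z w
    proof -
      have "grad (u l) z = 0" for z
        using 0(1)[of z] l by (simp add: dirichlet_def sum_nonneg_eq_0_iff)
      then have "(u l has_derivative (\<lambda>v. 0)) (at z within UNIV)" for z
        using u_has_derivative[OF l, of z] by simp
      then show ?thesis
        using has_derivative_zero_unique[of UNIV "u l" z w] by auto
    qed
    have "u a x = 0 \<or> u b x = 0" if "a \<in> {1..k}" "b \<in> {1..k}" "a < b" for a b
    proof -
      have "(\<Sum>j=a+1..k. (u a x)\<^sup>2 * (u j x)\<^sup>2) = 0"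
        using 0(2)[of x] that unfolding interaction_def
        by (subst (asm) sum_nonneg_eq_0_iff) (auto intro!: sum_nonneg)
      then have "(u a x)\<^sup>2 * (u b x)\<^sup>2 = 0"
        using that by (subst (asm) sum_nonneg_eq_0_iff) auto
      then show ?thesis by simp
    qed
    moreover have "u j x \<noteq> 0" using const[OF j(1), of x y] j by simp
    ultimately show False using i j ij by (metis linorder_neqE_nat)
  qed
  then obtain z where z: "dirichlet z + interaction z > 0" by blast
  define r where "r = max r0 (norm z + 1)"
  have "ball_energy r > 0"
    unfolding ball_energy_def
  proof (rule ball_integral_pos[where x=z])
    show "continuous_on UNIV (\<lambda>x. dirichlet x + interaction x)"
      by (intro continuous_intros continuous_dirichlet continuous_interaction)
  qed (use z dirichlet_nonneg interaction_nonneg in \<open>auto simp: r_def\<close>)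
  then show ?thesis by (intro exI[of _ r]) (auto simp: r_def)
qed

text \<open>For nonnegative components the sum of squares is at most the square of the sum, and
\<open>1 + r\<^bsup>p\<^esup> \<le> 2 r\<^bsup>p\<^esup>\<close> for \<open>r \<ge> 1\<close>.\<close>

lemma sphere_mass_growth:
  assumes nonneg: "\<And>i x. i \<in> {1..k} \<Longrightarrow> u i x \<ge> 0"
    and growth: "\<And>x. (\<Sum>i=1..k. u i x) \<le> c * (1 + norm x powr p)" and c: "c > 0" and p: "p \<ge> 0"
  obtains K where "\<And>r. r \<ge> 1 \<Longrightarrow> sphere_mass r \<le> K * r powr (2 * p)"
proof -
  interpret finite_measure "unit_sphere_measure :: 'a measure" by (rule finite_measure_unit_sphere)
  have bound: "sphere_mass r \<le> measure (unit_sphere_measure :: 'a measure) UNIV * (2 * c * r powr p)\<^sup>2" if r: "r \<ge> 1" for r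
  proof -
    have "sphere_mass r \<le> (\<integral>x. (2 * c * r powr p)\<^sup>2 \<partial>(unit_sphere_measure :: 'a measure))"
      unfolding sphere_mass_def
    proof (rule integral_mono_AE)
      show "integrable unit_sphere_measure (\<lambda>x. \<Sum>i=1..k. (u i (r *\<^sub>R x))\<^sup>2)"
        by (rule integrable_unit_sphere_scaled) (intro continuous_intros continuous_u)
      show "AE x in unit_sphere_measure. (\<Sum>i=1..k. (u i (r *\<^sub>R x))\<^sup>2) \<le> (2 * c * r powr p)\<^sup>2"
        using AE_unit_sphere_norm
      proof eventually_elim
        case (elim x)
        let ?y = "r *\<^sub>R x"
        have s0: "(\<Sum>i=1..k. u i ?y) \<ge> 0" using nonneg by (intro sum_nonneg) auto
        have "(\<Sum>i=1..k. (u i ?y)\<^sup>2) \<le> (\<Sum>i=1..k. u i ?y * (\<Sum>i=1..k. u i ?y))"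
          unfolding power2_eq_square
          by (intro sum_mono mult_left_mono member_le_sum) (use nonneg in auto)
        also have "\<dots> = (\<Sum>i=1..k. u i ?y)\<^sup>2" by (simp add: sum_distrib_right power2_eq_square)
        also have "\<dots> \<le> (2 * c * r powr p)\<^sup>2"
        proof (rule power_mono[OF _ s0])
          have "1 \<le> r powr p" using r p by (rule ge_one_powr_ge_zero)
          then have "c * (1 + r powr p) \<le> c * (2 * r powr p)" using c by (intro mult_left_mono) auto
          then show "(\<Sum>i=1..k. u i ?y) \<le> 2 * c * r powr p"
            using growth[of ?y] elim r by simp
        qed
        finally show ?case .
      qed
    qed simp
    then show ?thesis by simp
  qed
  show ?thesis
  proof (rule that)
    fix r :: real assume r: "r \<ge> 1"
    show "sphere_mass r \<le> (measure (unit_sphere_measure :: 'a measure) UNIV * (2 * c)\<^sup>2) * r powr (2 * p)"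
      using bound[OF r] r by (simp add: power_mult_distrib powr_power mult_ac)
  qed
qed

end

text \<open>The radial theory applied to the solution. With a real limit the extended reals are needed only for the
final statement.\<close>

theorem growth_rate_eq_limit_frequency:
  fixes u :: "nat \<Rightarrow> 'a::euclidean_space \<Rightarrow> real"
  assumes dim: "DIM('a) \<ge> 2" and sol: "nonneg_solution k u" and alg: "algebraic_growth k u"
  obtains d where "d > 0" "(N_fun k u 0 \<longlongrightarrow> d) at_top" "has_growth_rate k u d"
proof -
  interpret segregation_system k u
    using dim sol by unfold_locales (auto simp: nonneg_solution_def)
  obtain i j x y where ij: "i \<in> {1..k}" "j \<in> {1..k}" "i \<noteq> j" "u i x \<noteq> 0" "u j y \<noteq> 0"
    using sol unfolding nonneg_solution_def by blast
  obtain r0 where r0: "r0 > 0" and mass_pos: "\<And>r. r \<ge> r0 \<Longrightarrow> sphere_mass r > 0"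
    using sphere_mass_eventually_pos[OF ij(1,4)] by blast
  obtain c p where cp: "c > 0" "p > 1" "\<And>x. (\<Sum>i=1..k. u i x) \<le> c * (1 + norm x powr p)"
    using alg unfolding algebraic_growth_def by blast
  obtain K where K: "\<And>r. r \<ge> 1 \<Longrightarrow> sphere_mass r \<le> K * r powr (2 * p)"
    using sphere_mass_growth[of c p] cp sol unfolding nonneg_solution_def
    by (metis less_imp_le less_trans zero_less_one)
  define S where "S r = (\<integral>x. dirichlet (r *\<^sub>R x) + interaction (r *\<^sub>R x) \<partial>unit_sphere_measure)" for r
  define m where "m = DIM('a) - 2"
  have m: "DIM('a) = m + 2" using dim by (simp add: m_def)
  interpret almgren_quantities sphere_mass sphere_flux ball_energy "\<lambda>r. r ^ (m + 1) * S r"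
    ball_interaction sphere_normal_energy m r0 p K
  proof
    fix r :: real assume r: "r > 0"
    show "(ball_energy has_real_derivative r ^ (m + 1) * S r) (at r)"
      using ball_energy_derivative[OF r] m by (simp add: S_def)
    show "r * (r ^ (m + 1) * S r) = m * ball_energy r + 2 * ball_interaction r + 2 * r ^ (m + 2) * sphere_normal_energy r"
      using pohozaev_identity[OF r] unfolding S_def m by simp
    show "r ^ (m + 1) * sphere_flux r = ball_energy r + ball_interaction r"
      using flux_identity[OF r] unfolding m by simp
  qed (use r0 mass_pos K sphere_mass_derivative sphere_cauchy_schwarz ball_interaction_nonneg
        ball_energy_nonneg ball_energy_pos[OF ij(1,4,2,5,3)] in auto)
  have N: "frequency r = N_fun k u 0 r" if "r > 0" for r
    using that by (simp add: frequency_def N_fun_def H_fun_eq_sphere_mass E_fun_eq_ball_energy m)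
  have H: "\<forall>\<^sub>F r in at_top. sphere_mass r / r powr e = H_fun k u 0 r / r powr e" for e
    using eventually_gt_at_top[of 0] by eventually_elim (simp add: H_fun_eq_sphere_mass)
  show ?thesis
  proof (rule that)
    show "limit_frequency > 0" by (rule limit_frequency_pos)
    have "\<forall>\<^sub>F r in at_top. frequency r = N_fun k u 0 r"
      using eventually_gt_at_top[of 0] by eventually_elim (rule N)
    then show "(N_fun k u 0 \<longlongrightarrow> limit_frequency) at_top"
      by (rule Lim_transform_eventually[OF frequency_tendsto])
    show "has_growth_rate k u limit_frequency"
      unfolding has_growth_rate_def
    proof (intro conjI allI impI)
      fix d assume "d < limit_frequency"
      from H_dominates_lower_powers[OF this] show "filterlim (\<lambda>r. H_fun k u 0 r / r powr (2 * d)) at_top at_top"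
        by (rule filterlim_mono_eventually) (use H in auto)
    next
      fix d assume "d > limit_frequency"
      from H_dominated_by_higher_powers[OF this] show "((\<lambda>r. H_fun k u 0 r / r powr (2 * d)) \<longlongrightarrow> 0) at_top"
        by (rule Lim_transform_eventually) (rule H)
    qed
  qed
qed

theorem proposition1p5:
  fixes u :: "nat \<Rightarrow> real ^ 'n \<Rightarrow> real" and k :: nat
  assumes "CARD('n) \<ge> 2" and "k \<ge> 2"
    and "nonneg_solution k u"
    and "algebraic_growth k u"
  shows "((\<lambda>r. ereal (N_fun k u 0 r)) \<longlongrightarrow> N_infinity k u 0) at_top
       \<and> 0 < N_infinity k u 0 \<and> N_infinity k u 0 < \<infinity>
       \<and> has_growth_rate k u (real_of_ereal (N_infinity k u 0))"
proof -
  obtain d where d: "d > 0" "(N_fun k u 0 \<longlongrightarrow> d) at_top" "has_growth_rate k u d"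
    using growth_rate_eq_limit_frequency[of k u] assms by auto
  then have lim: "((\<lambda>r. ereal (N_fun k u 0 r)) \<longlongrightarrow> ereal d) at_top" by simp
  then have "N_infinity k u 0 = ereal d"
    unfolding N_infinity_def by (intro tendsto_Lim) auto
  then show ?thesis using d lim by simp
qed

end
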